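(* Let $G$ be a group and let $\mathcal{G}$ be a first order expansion of $G$ such that $\mathcal{G}$ defines (1) a basis for a locally compact Hausdorff group topology on $G$, and (2) a family $\mathcal{K}$ of compact subsets of $G$ (compact with respect to that topology) such that every compact subset of $G$ is contained in some element of $\mathcal{K}$. If $\mathcal{G}$ is $\mathrm{NIP}$, then the open core $\mathcal{G}^\circ$ of $\mathcal{G}$ is strongly noiseless.
   Context: "Definable" means definable with parameters. "$\mathcal{G}$ defines a basis (resp. a family)" means there is a $\mathcal{G}$-definable family of sets forming a basis of the topology (resp. equal to that family). Each $G^n$ carries the product topology. The open core $\mathcal{G}^\circ$ is the structure on $G$ whose primitive $n$-ary relations are the closures in $G^n$ of all $\mathcal{G}$-definable subsets of $G^n$. A structure $\mathcal{M}$ on a topologized set $M$ is strongly noiseless if whenever $X,Y$ are $\mathcal{M}$-definable subsets of the same $M^n$, then $X$ is either nowhere dense in $Y$ or has nonempty interior in $Y$ (with respect to the subspace topology on $Y$). *)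

theory Defs
  imports "HOL-Analysis.Analysis" "HOL-Algebra.Group"
begin

section \<open>First-order structures\<close>

text \<open>
  Elements of \<open>M\<^sup>n\<close> are the extensional functions on \<open>{..<n}\<close> with values in \<open>M\<close>; these are the
  points of \<open>product_topology (\<lambda>_. T) {..<n}\<close> when \<open>topspace T = M\<close>.
\<close>

abbreviation tuples :: "'a set \<Rightarrow> nat \<Rightarrow> (nat \<Rightarrow> 'a) set" where
  "tuples M n \<equiv> {..<n} \<rightarrow>\<^sub>E M"

definition tuple_of_list :: "'a list \<Rightarrow> nat \<Rightarrow> 'a" where
  "tuple_of_list xs = (\<lambda>i\<in>{..<length xs}. xs ! i)"

record ('f, 'r, 'a) fo_structure =
  universe :: "'a set"
  funs :: "'f set"
  rels :: "'r set"
  fun_arity :: "'f \<Rightarrow> nat"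
  rel_arity :: "'r \<Rightarrow> nat"
  fun_interp :: "'f \<Rightarrow> (nat \<Rightarrow> 'a) \<Rightarrow> 'a"
  rel_interp :: "'r \<Rightarrow> (nat \<Rightarrow> 'a) set"

definition is_structure :: "('f, 'r, 'a) fo_structure \<Rightarrow> bool" where
  "is_structure \<MM> \<longleftrightarrow>
     universe \<MM> \<noteq> {} \<and>
     (\<forall>f\<in>funs \<MM>. fun_interp \<MM> f \<in> tuples (universe \<MM>) (fun_arity \<MM> f) \<rightarrow> universe \<MM>) \<and>
     (\<forall>r\<in>rels \<MM>. rel_interp \<MM> r \<subseteq> tuples (universe \<MM>) (rel_arity \<MM> r))"

datatype 'f tm = Var nat | App 'f "'f tm list"

datatype ('f, 'r) fm =
    Equal "'f tm" "'f tm"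
  | Atom 'r "'f tm list"
  | Neg "('f, 'r) fm"
  | Conj "('f, 'r) fm" "('f, 'r) fm"
  | Exists nat "('f, 'r) fm"

primrec fv_tm :: "'f tm \<Rightarrow> nat set" where
  "fv_tm (Var i) = {i}"
| "fv_tm (App f ts) = \<Union> (set (map fv_tm ts))"

primrec fv :: "('f, 'r) fm \<Rightarrow> nat set" where
  "fv (Equal s t) = fv_tm s \<union> fv_tm t"
| "fv (Atom r ts) = (\<Union>t\<in>set ts. fv_tm t)"
| "fv (Neg \<phi>) = fv \<phi>"
| "fv (Conj \<phi> \<psi>) = fv \<phi> \<union> fv \<psi>"
| "fv (Exists i \<phi>) = fv \<phi> - {i}"

primrec wf_tm :: "('f, 'r, 'a) fo_structure \<Rightarrow> 'f tm \<Rightarrow> bool" where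
  "wf_tm \<MM> (Var i) \<longleftrightarrow> True"
| "wf_tm \<MM> (App f ts) \<longleftrightarrow>
     f \<in> funs \<MM> \<and> length ts = fun_arity \<MM> f \<and> list_all id (map (wf_tm \<MM>) ts)"

primrec wf_fm :: "('f, 'r, 'a) fo_structure \<Rightarrow> ('f, 'r) fm \<Rightarrow> bool" where
  "wf_fm \<MM> (Equal s t) \<longleftrightarrow> wf_tm \<MM> s \<and> wf_tm \<MM> t"
| "wf_fm \<MM> (Atom r ts) \<longleftrightarrow>
     r \<in> rels \<MM> \<and> length ts = rel_arity \<MM> r \<and> list_all (wf_tm \<MM>) ts"
| "wf_fm \<MM> (Neg \<phi>) \<longleftrightarrow> wf_fm \<MM> \<phi>"
| "wf_fm \<MM> (Conj \<phi> \<psi>) \<longleftrightarrow> wf_fm \<MM> \<phi> \<and> wf_fm \<MM> \<psi>"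
| "wf_fm \<MM> (Exists i \<phi>) \<longleftrightarrow> wf_fm \<MM> \<phi>"

primrec eval_tm :: "('f, 'r, 'a) fo_structure \<Rightarrow> (nat \<Rightarrow> 'a) \<Rightarrow> 'f tm \<Rightarrow> 'a" where
  "eval_tm \<MM> e (Var i) = e i"
| "eval_tm \<MM> e (App f ts) = fun_interp \<MM> f (tuple_of_list (map (eval_tm \<MM> e) ts))"

primrec sat :: "('f, 'r, 'a) fo_structure \<Rightarrow> (nat \<Rightarrow> 'a) \<Rightarrow> ('f, 'r) fm \<Rightarrow> bool" where
  "sat \<MM> e (Equal s t) \<longleftrightarrow> eval_tm \<MM> e s = eval_tm \<MM> e t"
| "sat \<MM> e (Atom r ts) \<longleftrightarrow> tuple_of_list (map (eval_tm \<MM> e) ts) \<in> rel_interp \<MM> r"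
| "sat \<MM> e (Neg \<phi>) \<longleftrightarrow> \<not> sat \<MM> e \<phi>"
| "sat \<MM> e (Conj \<phi> \<psi>) \<longleftrightarrow> sat \<MM> e \<phi> \<and> sat \<MM> e \<psi>"
| "sat \<MM> e (Exists i \<phi>) \<longleftrightarrow> (\<exists>a\<in>universe \<MM>. sat \<MM> (e(i := a)) \<phi>)"


section \<open>Definability and NIP\<close>

definition tuple_append :: "nat \<Rightarrow> (nat \<Rightarrow> 'a) \<Rightarrow> (nat \<Rightarrow> 'a) \<Rightarrow> nat \<Rightarrow> 'a" where
  "tuple_append n x y = (\<lambda>i. if i < n then x i else y (i - n))"

text \<open>Definability is with parameters: \<open>c\<close> below is the tuple of parameters.\<close>

definition definable :: "('f, 'r, 'a) fo_structure \<Rightarrow> nat \<Rightarrow> (nat \<Rightarrow> 'a) set \<Rightarrow> bool" where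
  "definable \<MM> n X \<longleftrightarrow>
     (\<exists>\<phi> m. \<exists>c\<in>tuples (universe \<MM>) m.
        wf_fm \<MM> \<phi> \<and> fv \<phi> \<subseteq> {..<n + m} \<and>
        X = {x \<in> tuples (universe \<MM>) n. sat \<MM> (tuple_append n x c) \<phi>})"

text \<open>
  A definable family of subsets of \<open>M\<close>: the fibres over a definable \<open>B \<subseteq> M\<^sup>m\<close> of a definable
  \<open>X \<subseteq> M\<^sup>m\<^sup>+\<^sup>1\<close>, where \<open>b(m := x)\<close> is the tuple \<open>b\<close> extended by the last coordinate \<open>x\<close>.
\<close>

definition definable_family :: "('f, 'r, 'a) fo_structure \<Rightarrow> 'a set set \<Rightarrow> bool" where
  "definable_family \<MM> \<F> \<longleftrightarrow>
     (\<exists>m B X. definable \<MM> m B \<and> definable \<MM> (Suc m) X \<and>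
        \<F> = (\<lambda>b. {x \<in> universe \<MM>. b(m := x) \<in> X}) ` B)"

text \<open>
  \<open>\<phi>(x;y)\<close> with \<open>|x| = p\<close> and \<open>|y| = q\<close> has the independence property if its instances \<open>\<phi>(x;b)\<close>
  shatter arbitrarily large finite sets of \<open>p\<close>-tuples. This is a property of the theory of the
  structure.
\<close>

definition shatters ::
  "('f, 'r, 'a) fo_structure \<Rightarrow> nat \<Rightarrow> nat \<Rightarrow> ('f, 'r) fm \<Rightarrow> (nat \<Rightarrow> 'a) set \<Rightarrow> bool" where
  "shatters \<MM> p q \<phi> A \<longleftrightarrow>
     (\<forall>S\<subseteq>A. \<exists>b\<in>tuples (universe \<MM>) q. \<forall>a\<in>A. sat \<MM> (tuple_append p a b) \<phi> \<longleftrightarrow> a \<in> S)"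

definition has_IP ::
  "('f, 'r, 'a) fo_structure \<Rightarrow> nat \<Rightarrow> nat \<Rightarrow> ('f, 'r) fm \<Rightarrow> bool" where
  "has_IP \<MM> p q \<phi> \<longleftrightarrow>
     (\<forall>k. \<exists>A\<subseteq>tuples (universe \<MM>) p. finite A \<and> card A = k \<and> shatters \<MM> p q \<phi> A)"

definition NIP :: "('f, 'r, 'a) fo_structure \<Rightarrow> bool" where
  "NIP \<MM> \<longleftrightarrow> (\<forall>\<phi> p q. wf_fm \<MM> \<phi> \<and> fv \<phi> \<subseteq> {..<p + q} \<longrightarrow> \<not> has_IP \<MM> p q \<phi>)"


section \<open>Expansions of groups, and topology\<close>

text \<open>
  Only multiplication is required to be a primitive; the identity and inversion are definable
  from it.
\<close>

definition expands_group :: "('f, 'r, 'a) fo_structure \<Rightarrow> ('a, 'b) monoid_scheme \<Rightarrow> bool" where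
  "expands_group \<MM> G \<longleftrightarrow>
     is_structure \<MM> \<and> universe \<MM> = carrier G \<and>
     (\<exists>f\<in>funs \<MM>. fun_arity \<MM> f = 2 \<and>
        (\<forall>x\<in>carrier G. \<forall>y\<in>carrier G. fun_interp \<MM> f (tuple_of_list [x, y]) = x \<otimes>\<^bsub>G\<^esub> y))"

definition group_topology :: "('a, 'b) monoid_scheme \<Rightarrow> 'a topology \<Rightarrow> bool" where
  "group_topology G T \<longleftrightarrow>
     topspace T = carrier G \<and>
     continuous_map (prod_topology T T) T (\<lambda>(x, y). x \<otimes>\<^bsub>G\<^esub> y) \<and>
     continuous_map T T (\<lambda>x. inv\<^bsub>G\<^esub> x)"

definition topology_basis :: "'a topology \<Rightarrow> 'a set set \<Rightarrow> bool" where
  "topology_basis T \<B> \<longleftrightarrow> openin T = arbitrary union_of (\<lambda>U. U \<in> \<B>)"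

abbreviation power_topology :: "'a topology \<Rightarrow> nat \<Rightarrow> (nat \<Rightarrow> 'a) topology" where
  "power_topology T n \<equiv> product_topology (\<lambda>_. T) {..<n}"

text \<open>
  The open core has one relation symbol \<open>(n, R)\<close> for each closure \<open>R\<close> of a definable subset of
  \<open>M\<^sup>n\<close>, interpreted by \<open>R\<close> itself, and no function symbols; the type argument \<open>unit\<close> is a dummy.
\<close>

definition open_core ::
  "'a topology \<Rightarrow> ('f, 'r, 'a) fo_structure \<Rightarrow> (unit, nat \<times> (nat \<Rightarrow> 'a) set, 'a) fo_structure"
  where
  "open_core T \<MM> =
     \<lparr>universe = universe \<MM>,
      funs = {},
      rels = {(n, power_topology T n closure_of X) | n X. definable \<MM> n X},
      fun_arity = (\<lambda>_. 0),
      rel_arity = fst,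
      fun_interp = (\<lambda>_. undefined),
      rel_interp = snd\<rparr>"

definition nowhere_dense_in :: "'a topology \<Rightarrow> 'a set \<Rightarrow> 'a set \<Rightarrow> bool" where
  "nowhere_dense_in T X Y \<longleftrightarrow>
     subtopology T Y interior_of (subtopology T Y closure_of (X \<inter> Y)) = {}"

definition has_interior_in :: "'a topology \<Rightarrow> 'a set \<Rightarrow> 'a set \<Rightarrow> bool" where
  "has_interior_in T X Y \<longleftrightarrow> subtopology T Y interior_of (X \<inter> Y) \<noteq> {}"

definition strongly_noiseless :: "'a topology \<Rightarrow> ('f, 'r, 'a) fo_structure \<Rightarrow> bool" where
  "strongly_noiseless T \<MM> \<longleftrightarrow>
     (\<forall>n X Y. definable \<MM> n X \<and> definable \<MM> n Y \<longrightarrow>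
        nowhere_dense_in (power_topology T n) X Y \<or> has_interior_in (power_topology T n) X Y)"

end

theory Submission
  imports Defs
begin

text \<open>
  Call \<open>A \<subseteq> G\<^sup>n\<close> externally definable if one definable family \<open>(R\<^sub>b)\<close> separates any finite
  \<open>F \<subseteq> A\<close> from any finite \<open>F' \<subseteq> G\<^sup>n - A\<close> in the strong sense that some \<open>R\<^sub>b\<close> contains a
  neighbourhood of \<open>F\<close> and misses a neighbourhood of \<open>F'\<close>. Closed definable sets \<open>C\<close> are of this kind,
  by the thickenings \<open>V C\<close> with \<open>V\<close> a basic neighbourhood of the identity, and the class is closed
  under Boolean combinations.

  For projections one needs NIP: an externally definable \<open>A\<close> has an honest definition, that is, a
  definable family such that every finite \<open>F \<subseteq> A\<close> lies in a compact \<open>L \<subseteq> A\<close> that is a limit of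
  members containing neighbourhoods of \<open>F\<close>. The subsets of \<open>A\<close> with this property form an ideal; if it
  were proper, an ultrafilter avoiding it would generate a Morley sequence, and any pattern of
  membership in \<open>A\<close> could be realised along sequences of the same type, so the separating family
  would shatter arbitrarily large finite sets. Honest definitions do project, because \<open>L\<close> is compact.
  Hence every set definable in the open core is externally definable.

  Finally, if \<open>X\<close> is externally definable and both \<open>X\<close> and its complement are dense in a nonempty
  relatively open subset of \<open>Y\<close>, then inductively splitting open sets by members of the separating
  family contradicts NIP.
\<close>

section \<open>Definable predicates on environments\<close>

lemma eval_tm_cong:
  "(\<And>i. i \<in> fv_tm t \<Longrightarrow> e i = e' i) \<Longrightarrow> eval_tm \<MM> e t = eval_tm \<MM> e' t"
proof (induction t)
  case (App f ts)
  then have "map (eval_tm \<MM> e) ts = map (eval_tm \<MM> e') ts" by auto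
  then show ?case by (simp only: eval_tm.simps)
qed simp

lemma sat_cong:
  "(\<And>i. i \<in> fv \<phi> \<Longrightarrow> e i = e' i) \<Longrightarrow> sat \<MM> e \<phi> = sat \<MM> e' \<phi>"
proof (induction \<phi> arbitrary: e e')
  case (Equal s t)
  have "eval_tm \<MM> e s = eval_tm \<MM> e' s" "eval_tm \<MM> e t = eval_tm \<MM> e' t"
    by (rule eval_tm_cong, use Equal in simp)+
  then show ?case by simp
next
  case (Atom r ts)
  then have "map (eval_tm \<MM> e) ts = map (eval_tm \<MM> e') ts"
    by (auto intro!: eval_tm_cong)
  then show ?case by (simp only: sat.simps)
next
  case (Neg \<phi>)
  have "sat \<MM> e \<phi> = sat \<MM> e' \<phi>"
    by (rule Neg.IH) (use Neg.prems in auto)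
  then show ?case by simp
next
  case (Conj \<phi>1 \<phi>2)
  have "sat \<MM> e \<phi>1 = sat \<MM> e' \<phi>1" "sat \<MM> e \<phi>2 = sat \<MM> e' \<phi>2"
    by (rule Conj.IH, use Conj.prems in simp)+
  then show ?case by simp
next
  case (Exists i \<phi>)
  have "sat \<MM> (e(i := a)) \<phi> = sat \<MM> (e'(i := a)) \<phi>" for a
    by (rule Exists.IH) (use Exists.prems in auto)
  then show ?case by simp
qed

lemma finite_fv_tm: "finite (fv_tm t)"
  by (induction t) auto

lemma finite_fv: "finite (fv \<phi>)"
  by (induction \<phi>) (auto simp: finite_fv_tm)

primrec rename_tm :: "(nat \<Rightarrow> nat) \<Rightarrow> 'f tm \<Rightarrow> 'f tm" where
  "rename_tm g (Var i) = Var (g i)"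
| "rename_tm g (App f ts) = App f (map (rename_tm g) ts)"

lemma eval_rename_tm: "eval_tm \<MM> e (rename_tm g t) = eval_tm \<MM> (\<lambda>i. e (g i)) t"
proof (induction t)
  case (App f ts)
  then have "map (eval_tm \<MM> e) (map (rename_tm g) ts) = map (eval_tm \<MM> (\<lambda>i. e (g i))) ts" by simp
  then show ?case by (simp only: rename_tm.simps eval_tm.simps)
qed simp

lemma wf_rename_tm: "wf_tm \<MM> (rename_tm g t) = wf_tm \<MM> t"
  by (induction t) (auto simp: list_all_iff)

lemma fv_rename_tm: "fv_tm (rename_tm g t) = g ` fv_tm t"
  by (induction t) auto

text \<open>As \<open>g\<close> need not be injective, renamed free variables could be captured, so
  each quantifier receives a fresh bound variable. Claiming only that a formula exists avoids fixing
  how that variable is chosen.\<close>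

lemma sat_rename_exists:
  "wf_fm \<MM> \<phi> \<Longrightarrow> \<exists>\<psi>. wf_fm \<MM> \<psi> \<and> fv \<psi> \<subseteq> g ` fv \<phi> \<and> (\<forall>e. sat \<MM> e \<psi> = sat \<MM> (\<lambda>i. e (g i)) \<phi>)"
proof (induction \<phi> arbitrary: g)
  case (Equal s t)
  show ?case
    by (rule exI[of _ "Equal (rename_tm g s) (rename_tm g t)"])
      (use Equal in \<open>auto simp: eval_rename_tm wf_rename_tm fv_rename_tm\<close>)
next
  case (Atom r ts)
  have "map (eval_tm \<MM> e) (map (rename_tm g) ts) = map (eval_tm \<MM> (\<lambda>i. e (g i))) ts" for e
    by (auto simp: eval_rename_tm)
  then show ?case
    by (intro exI[of _ "Atom r (map (rename_tm g) ts)"])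
      (use Atom in \<open>auto simp: wf_rename_tm fv_rename_tm list_all_iff simp del: map_map\<close>)
next
  case (Neg \<phi>)
  then obtain \<psi> where "wf_fm \<MM> \<psi>" "fv \<psi> \<subseteq> g ` fv \<phi>" "\<forall>e. sat \<MM> e \<psi> = sat \<MM> (\<lambda>i. e (g i)) \<phi>"
    by (metis wf_fm.simps(3))
  then show ?case by (intro exI[of _ "Neg \<psi>"]) auto
next
  case (Conj \<phi>1 \<phi>2)
  then obtain \<psi>1 \<psi>2
    where "wf_fm \<MM> \<psi>1" "fv \<psi>1 \<subseteq> g ` fv \<phi>1" "\<forall>e. sat \<MM> e \<psi>1 = sat \<MM> (\<lambda>i. e (g i)) \<phi>1"
      "wf_fm \<MM> \<psi>2" "fv \<psi>2 \<subseteq> g ` fv \<phi>2" "\<forall>e. sat \<MM> e \<psi>2 = sat \<MM> (\<lambda>i. e (g i)) \<phi>2"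
    by (metis wf_fm.simps(4))
  then show ?case by (intro exI[of _ "Conj \<psi>1 \<psi>2"]) auto
next
  case (Exists i \<phi>)
  obtain j where j: "j \<notin> g ` fv \<phi>"
    using ex_new_if_finite[OF infinite_UNIV_nat finite_imageI[OF finite_fv]] by blast
  obtain \<psi> where \<psi>: "wf_fm \<MM> \<psi>" "fv \<psi> \<subseteq> g(i := j) ` fv \<phi>"
    "\<forall>e. sat \<MM> e \<psi> = sat \<MM> (\<lambda>k. e ((g(i := j)) k)) \<phi>"
    using Exists by (metis wf_fm.simps(5))
  have "sat \<MM> (\<lambda>k. (e(j := a)) ((g(i := j)) k)) \<phi> = sat \<MM> ((\<lambda>i. e (g i))(i := a)) \<phi>" for e a
    by (rule sat_cong) (use j in auto)
  moreover have "fv (Exists j \<psi>) \<subseteq> g ` fv (Exists i \<phi>)"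
    using \<psi>(2) by auto
  ultimately show ?case
    using \<psi> by (intro exI[of _ "Exists j \<psi>"]) auto
qed

section \<open>Cutting and joining tuples\<close>

definition seg :: "nat \<Rightarrow> nat \<Rightarrow> (nat \<Rightarrow> 'a) \<Rightarrow> nat \<Rightarrow> 'a" where
  "seg k n e = (\<lambda>i\<in>{..<n}. e (k + i))"

definition shift :: "nat \<Rightarrow> (nat \<Rightarrow> 'a) \<Rightarrow> nat \<Rightarrow> 'a" where
  "shift m e = (\<lambda>i. e (m + i))"

text \<open>Unlike \<open>tuple_append\<close>, the result is cut off at length
  \<open>n + m\<close>, which makes it a point of the power of that length.\<close>

definition tuple_join :: "nat \<Rightarrow> nat \<Rightarrow> (nat \<Rightarrow> 'a) \<Rightarrow> (nat \<Rightarrow> 'a) \<Rightarrow> nat \<Rightarrow> 'a" where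
  "tuple_join n m x y = (\<lambda>i\<in>{..<n + m}. if i < n then x i else y (i - n))"

lemma seg_shift [simp]: "seg k n (shift m e) = seg (m + k) n e"
  by (simp add: seg_def shift_def add.assoc)

lemma shift_apply [simp]: "shift m e i = e (m + i)"
  by (simp add: shift_def)

lemma shift_shift [simp]: "shift k (shift m e) = shift (m + k) e"
  by (simp add: shift_def add.assoc)

lemma seg_append [simp]: "x \<in> tuples M n \<Longrightarrow> seg 0 n (tuple_append n x e) = x"
  by (auto simp: seg_def tuple_append_def fun_eq_iff PiE_def extensional_def)

lemma shift_append [simp]: "shift n (tuple_append n x e) = e"
  by (auto simp: shift_def tuple_append_def)

lemma seg_in_tuples: "(\<And>i. i < n \<Longrightarrow> e (k + i) \<in> M) \<Longrightarrow> seg k n e \<in> tuples M n"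
  by (auto simp: seg_def)

lemma seg_tuple_in_tuples: "a \<in> tuples M N \<Longrightarrow> k + n \<le> N \<Longrightarrow> seg k n a \<in> tuples M n"
  by (rule seg_in_tuples, erule PiE_mem) simp

lemma tuple_join_in_tuples:
  "x \<in> tuples M n \<Longrightarrow> y \<in> tuples M m \<Longrightarrow> tuple_join n m x y \<in> tuples M (n + m)"
  by (auto simp: tuple_join_def PiE_iff)

lemma seg_tuple_join_left:
  "x \<in> tuples M n \<Longrightarrow> seg 0 n (tuple_join n m x y) = x"
  by (auto simp: seg_def tuple_join_def fun_eq_iff PiE_def extensional_def)

lemma seg_tuple_join_right:
  "y \<in> tuples M m \<Longrightarrow> seg n m (tuple_join n m x y) = y"
  by (auto simp: seg_def tuple_join_def fun_eq_iff PiE_def extensional_def)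

lemma seg_tuple_join_add:
  assumes "k + l \<le> m"
  shows "seg (n + k) l (tuple_join n m x y) = seg k l y"
  using assms by (auto simp: seg_def tuple_join_def fun_eq_iff)

section \<open>Closure properties of definable predicates\<close>

text \<open>\<open>c\<close> is a tuple of parameters, stored in front of the environment.\<close>

definition defpred :: "('f, 'r, 'a) fo_structure \<Rightarrow> ((nat \<Rightarrow> 'a) \<Rightarrow> bool) \<Rightarrow> bool" where
  "defpred \<MM> P \<longleftrightarrow> (\<exists>\<phi> m. \<exists>c\<in>tuples (universe \<MM>) m. wf_fm \<MM> \<phi> \<and>
     (\<forall>e. (\<forall>i. e i \<in> universe \<MM>) \<longrightarrow> P e = sat \<MM> (tuple_append m c e) \<phi>))"

definition defset :: "('f, 'r, 'a) fo_structure \<Rightarrow> nat \<Rightarrow> (nat \<Rightarrow> 'a) set \<Rightarrow> bool" where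
  "defset \<MM> n X \<longleftrightarrow> defpred \<MM> (\<lambda>e. seg 0 n e \<in> X)"

text \<open>This encodes a definable family of sets of \<open>n\<close>-tuples: the first block of
  variables is the point, the second the index of the member.\<close>

definition defrel ::
  "('f, 'r, 'a) fo_structure \<Rightarrow> nat \<Rightarrow> nat \<Rightarrow> ((nat \<Rightarrow> 'a) \<Rightarrow> (nat \<Rightarrow> 'a) \<Rightarrow> bool) \<Rightarrow> bool" where
  "defrel \<MM> n q R \<longleftrightarrow> defpred \<MM> (\<lambda>e. R (seg 0 n e) (seg n q e))"

text \<open>Terms that merely select variables. Substituting them into a definable predicate only
  reindexes the environment, so definability of compound conditions follows by matching introduction
  rules on their shape.\<close>

definition tuple_term :: "nat \<Rightarrow> ((nat \<Rightarrow> 'a) \<Rightarrow> nat \<Rightarrow> 'a) \<Rightarrow> bool" where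
  "tuple_term n t \<longleftrightarrow> (\<exists>g. \<forall>e. t e = (\<lambda>i\<in>{..<n}. e (g i)))"

definition var_term :: "((nat \<Rightarrow> 'a) \<Rightarrow> 'a) \<Rightarrow> bool" where
  "var_term v \<longleftrightarrow> (\<exists>j. \<forall>e. v e = e j)"

lemma defpredE:
  assumes "defpred \<MM> P"
  obtains \<phi> m c where "c \<in> tuples (universe \<MM>) m" "wf_fm \<MM> \<phi>"
    "\<And>e. \<forall>i. e i \<in> universe \<MM> \<Longrightarrow> P e = sat \<MM> (tuple_append m c e) \<phi>"
proof -
  from assms obtain \<phi> m c where *: "c \<in> tuples (universe \<MM>) m" "wf_fm \<MM> \<phi>"
    "\<forall>e. (\<forall>i. e i \<in> universe \<MM>) \<longrightarrow> P e = sat \<MM> (tuple_append m c e) \<phi>"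
    unfolding defpred_def by (elim exE bexE conjE) (rule that)
  show thesis by (rule that[OF *(1,2)]) (rule *(3)[rule_format], blast)
qed

lemma defpredI:
  assumes "c \<in> tuples (universe \<MM>) m" "wf_fm \<MM> \<phi>"
    "\<And>e. \<forall>i. e i \<in> universe \<MM> \<Longrightarrow> P e = sat \<MM> (tuple_append m c e) \<phi>"
  shows "defpred \<MM> P"
  unfolding defpred_def
  by (rule exI[of _ \<phi>], rule exI[of _ m], rule bexI[OF _ assms(1)]) (use assms in simp)

lemma defpred_cong:
  assumes "defpred \<MM> P" "\<And>e. (\<And>i. e i \<in> universe \<MM>) \<Longrightarrow> P e = Q e"
  shows "defpred \<MM> Q"
proof -
  obtain \<phi> m c where "c \<in> tuples (universe \<MM>) m" "wf_fm \<MM> \<phi>"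
    "\<And>e. \<forall>i. e i \<in> universe \<MM> \<Longrightarrow> P e = sat \<MM> (tuple_append m c e) \<phi>"
    by (rule defpredE[OF assms(1)]) (rule that)
  then show ?thesis using assms(2) by (intro defpredI[where \<phi> = \<phi> and m = m and c = c]) auto
qed

lemma defpred_not:
  assumes "defpred \<MM> P" shows "defpred \<MM> (\<lambda>e. \<not> P e)"
proof -
  obtain \<phi> m c where "c \<in> tuples (universe \<MM>) m" "wf_fm \<MM> \<phi>"
    "\<And>e. \<forall>i. e i \<in> universe \<MM> \<Longrightarrow> P e = sat \<MM> (tuple_append m c e) \<phi>"
    by (rule defpredE[OF assms]) (rule that)
  then show ?thesis
    unfolding defpred_def by (intro exI[of _ "Neg \<phi>"] exI[of _ m] bexI[of _ c]) auto
qed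

lemma defpred_reindex:
  assumes "defpred \<MM> P" shows "defpred \<MM> (\<lambda>e. P (\<lambda>i. e (g i)))"
proof -
  obtain \<phi> m c where *: "c \<in> tuples (universe \<MM>) m" "wf_fm \<MM> \<phi>"
    "\<And>e. \<forall>i. e i \<in> universe \<MM> \<Longrightarrow> P e = sat \<MM> (tuple_append m c e) \<phi>"
    by (rule defpredE[OF assms]) (rule that)
  define f where "f i = (if i < m then i else m + g (i - m))" for i
  obtain \<psi> where "wf_fm \<MM> \<psi>" "\<forall>e. sat \<MM> e \<psi> = sat \<MM> (\<lambda>i. e (f i)) \<phi>"
    using sat_rename_exists[OF *(2)] by blast
  moreover have "(\<lambda>i. tuple_append m c e (f i)) = tuple_append m c (\<lambda>i. e (g i))" for e
    by (auto simp: f_def tuple_append_def)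
  ultimately show ?thesis
    using * unfolding defpred_def by (intro exI[of _ \<psi>] exI[of _ m] bexI[of _ c]) auto
qed

text \<open>Since parameters are allowed, the values \<open>d\<close> can move from the environment
  to the end of the parameter tuple.\<close>

lemma defpred_const:
  assumes "defpred \<MM> (\<lambda>e. Q (seg 0 m e) (shift m e))" "d \<in> tuples (universe \<MM>) m"
  shows "defpred \<MM> (Q d)"
proof -
  obtain \<phi> k c where *: "c \<in> tuples (universe \<MM>) k" "wf_fm \<MM> \<phi>"
    "\<And>e. \<forall>i. e i \<in> universe \<MM> \<Longrightarrow> Q (seg 0 m e) (shift m e) = sat \<MM> (tuple_append k c e) \<phi>"
    by (rule defpredE[OF assms(1)]) (rule that)
  have "Q d e = sat \<MM> (tuple_append (k + m) (tuple_join k m c d) e) \<phi>"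
    if e: "\<forall>i. e i \<in> universe \<MM>" for e
  proof -
    have "\<forall>i. tuple_append m d e i \<in> universe \<MM>"
      using assms(2) e by (auto simp: tuple_append_def)
    from *(3)[OF this] have "Q d e = sat \<MM> (tuple_append k c (tuple_append m d e)) \<phi>"
      by (simp only: seg_append[OF assms(2)] shift_append)
    also have "tuple_append k c (tuple_append m d e) = tuple_append (k + m) (tuple_join k m c d) e"
      by (auto simp: tuple_append_def tuple_join_def fun_eq_iff diff_diff_left)
    finally show ?thesis .
  qed
  then show ?thesis
    by (rule defpredI[OF tuple_join_in_tuples[OF *(1) assms(2)] *(2)])
qed

lemma defpred_conj:
  assumes "defpred \<MM> P" "defpred \<MM> Q" shows "defpred \<MM> (\<lambda>e. P e \<and> Q e)"
proof -
  obtain \<phi> m c where 1: "c \<in> tuples (universe \<MM>) m" "wf_fm \<MM> \<phi>"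
    "\<And>e. \<forall>i. e i \<in> universe \<MM> \<Longrightarrow> P e = sat \<MM> (tuple_append m c e) \<phi>"
    by (rule defpredE[OF assms(1)]) (rule that)
  obtain \<psi> k d where 2: "d \<in> tuples (universe \<MM>) k" "wf_fm \<MM> \<psi>"
    "\<And>e. \<forall>i. e i \<in> universe \<MM> \<Longrightarrow> Q e = sat \<MM> (tuple_append k d e) \<psi>"
    by (rule defpredE[OF assms(2)]) (rule that)
  \<comment> \<open>Both formulas are to read the joined tuple \<open>?cd\<close>: \<open>f\<close>
    jumps over the block \<open>d\<close>, \<open>g\<close> over the block \<open>c\<close>.\<close>
  define f where "f i = (if i < m then i else k + i)" for i
  define g where "g i = m + i" for i :: nat
  let ?cd = "tuple_join m k c d"
  obtain \<phi>' where \<phi>': "wf_fm \<MM> \<phi>'" "\<forall>e. sat \<MM> e \<phi>' = sat \<MM> (\<lambda>i. e (f i)) \<phi>"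
    using sat_rename_exists[OF 1(2)] by blast
  obtain \<psi>' where \<psi>': "wf_fm \<MM> \<psi>'" "\<forall>e. sat \<MM> e \<psi>' = sat \<MM> (\<lambda>i. e (g i)) \<psi>"
    using sat_rename_exists[OF 2(2)] by blast
  have "(\<lambda>i. tuple_append (m + k) ?cd e (f i)) = tuple_append m c e" for e
    by (auto simp: f_def tuple_append_def tuple_join_def fun_eq_iff)
  moreover have "(\<lambda>i. tuple_append (m + k) ?cd e (g i)) = tuple_append k d e" for e
    by (auto simp: g_def tuple_append_def tuple_join_def fun_eq_iff)
  ultimately show ?thesis
    using 1 2 \<phi>' \<psi>' tuple_join_in_tuples[OF 1(1) 2(1)] unfolding defpred_def
    by (intro exI[of _ "Conj \<phi>' \<psi>'"] exI[of _ "m + k"] bexI[of _ ?cd]) auto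
qed

lemma defpred_disj:
  assumes "defpred \<MM> P" "defpred \<MM> Q" shows "defpred \<MM> (\<lambda>e. P e \<or> Q e)"
proof -
  have "defpred \<MM> (\<lambda>e. \<not> (\<not> P e \<and> \<not> Q e))"
    by (intro defpred_not defpred_conj assms)
  then show ?thesis by simp
qed

lemma defpred_imp:
  assumes "defpred \<MM> P" "defpred \<MM> Q" shows "defpred \<MM> (\<lambda>e. P e \<longrightarrow> Q e)"
  using defpred_disj[OF defpred_not[OF assms(1)] assms(2)] by (simp only: imp_conv_disj)

lemma defpred_bex:
  assumes "defpred \<MM> (\<lambda>e. Q (e 0) (shift 1 e))"
  shows "defpred \<MM> (\<lambda>e. \<exists>a\<in>universe \<MM>. Q a e)"
proof -
  obtain \<phi> m c where *: "c \<in> tuples (universe \<MM>) m" "wf_fm \<MM> \<phi>"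
    "\<And>e. \<forall>i. e i \<in> universe \<MM> \<Longrightarrow> Q (e 0) (shift 1 e) = sat \<MM> (tuple_append m c e) \<phi>"
    by (rule defpredE[OF assms]) (rule that)
  \<comment> \<open>The quantified value sits at index \<open>m\<close>, behind the parameters;
    \<open>f\<close> brings it to index 0, where \<open>Exists 0\<close> binds it, and moves the
    parameters up by one.\<close>
  define f where "f i = (if i < m then Suc i else if i = m then 0 else i)" for i
  obtain \<psi> where \<psi>: "wf_fm \<MM> \<psi>" "\<forall>e. sat \<MM> e \<psi> = sat \<MM> (\<lambda>i. e (f i)) \<phi>"
    using sat_rename_exists[OF *(2)] by blast
  have "wf_fm \<MM> (Exists 0 \<psi>)" using \<psi> by simp
  \<comment> \<open>This undoes the shift. Sending both 0 and 1 to 0 is harmless, because index 0 is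
    overwritten by the quantifier.\<close>
  from sat_rename_exists[OF this, of "\<lambda>i. i - 1"]
  obtain \<theta> where \<theta>: "wf_fm \<MM> \<theta>"
    "\<forall>e. sat \<MM> e \<theta> = sat \<MM> (\<lambda>i. e (i - 1)) (Exists 0 \<psi>)" by blast
  have "(\<exists>a\<in>universe \<MM>. Q a e) = sat \<MM> (tuple_append m c e) \<theta>"
    if e: "\<forall>i. e i \<in> universe \<MM>" for e
  proof -
    have "Q a e = sat \<MM> ((\<lambda>i. tuple_append m c e (i - 1))(0 := a)) \<psi>"
      if a: "a \<in> universe \<MM>" for a
    proof -
      have "\<forall>i. case_nat a e i \<in> universe \<MM>" using a e by (auto split: nat.split)
      from *(3)[OF this] have "Q a e = sat \<MM> (tuple_append m c (case_nat a e)) \<phi>"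
        by (simp add: shift_def)
      also have "tuple_append m c (case_nat a e) = (\<lambda>i. ((\<lambda>i. tuple_append m c e (i - 1))(0 := a)) (f i))"
        by (auto simp: fun_eq_iff tuple_append_def f_def split: nat.split) (intro arg_cong[of _ _ e]; simp)
      finally show ?thesis using \<psi> by simp
    qed
    then show ?thesis using \<theta> by simp
  qed
  then show ?thesis
    by (rule defpredI[OF *(1) \<theta>(1)])
qed

lemma tuples_Suc_iff:
  "b \<in> tuples M (Suc m) \<longleftrightarrow> (\<exists>b'\<in>tuples M m. \<exists>a\<in>M. b = b'(m := a))"
  by (auto simp: lessThan_Suc PiE_insert_eq)

lemma defpred_bex_tuple:
  "defpred \<MM> (\<lambda>e. Q (seg 0 m e) (shift m e)) \<Longrightarrow> defpred \<MM> (\<lambda>e. \<exists>b\<in>tuples (universe \<MM>) m. Q b e)"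
proof (induction m arbitrary: Q)
  case 0
  then show ?case by (simp add: seg_def shift_def)
next
  case (Suc m)
  \<comment> \<open>\<open>g\<close> makes the last coordinate come from index 0, where
    \<open>defpred_bex\<close> quantifies; the first \<open>m\<close> are left to the induction
    hypothesis.\<close>
  define g where "g i = (if i < m then i + 1 else if i = m then 0 else i)" for i
  have re: "defpred \<MM> (\<lambda>e. Q (seg 0 (Suc m) (\<lambda>i. e (g i))) (shift (Suc m) (\<lambda>i. e (g i))))"
    using defpred_reindex[OF Suc.prems] .
  have seg: "seg 0 (Suc m) (\<lambda>i. e (g i)) = (seg 1 m e)(m := e 0)" for e
    by (auto simp: seg_def g_def fun_eq_iff)
  have shift: "shift (Suc m) (\<lambda>i. e (g i)) = shift (Suc m) e" for e
    by (auto simp: shift_def g_def fun_eq_iff)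
  have "defpred \<MM> (\<lambda>e. \<exists>a\<in>universe \<MM>. Q ((seg 0 m e)(m := a)) (shift m e))"
    using re unfolding seg shift by (intro defpred_bex) simp
  from Suc.IH[OF this]
  have "defpred \<MM> (\<lambda>e. \<exists>b\<in>tuples (universe \<MM>) m. \<exists>a\<in>universe \<MM>. Q (b(m := a)) e)" .
  then show ?case
    by (rule defpred_cong) (auto simp: tuples_Suc_iff Bex_def)
qed

lemma defpred_ball_tuple:
  assumes "defpred \<MM> (\<lambda>e. Q (seg 0 m e) (shift m e))"
  shows "defpred \<MM> (\<lambda>e. \<forall>b\<in>tuples (universe \<MM>) m. Q b e)"
  using defpred_not[OF defpred_bex_tuple[of \<MM> "\<lambda>b e. \<not> Q b e", OF defpred_not[OF assms]]] by simp

lemma defpred_eq: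
  assumes "var_term v" "var_term w" shows "defpred \<MM> (\<lambda>e. v e = w e)"
proof -
  obtain i j where "\<forall>e. v e = e i" "\<forall>e. w e = e j"
    using assms unfolding var_term_def by (elim exE) (rule that)
  then show ?thesis
    unfolding defpred_def
    by (intro exI[of _ "Equal (Var i) (Var j)"] exI[of _ 0] bexI[of _ "\<lambda>_. undefined"])
      (auto simp: tuple_append_def)
qed

lemma defpred_True: "defpred \<MM> (\<lambda>e. True)"
  using defpred_eq[of "\<lambda>e. e 0" "\<lambda>e. e 0"] by (auto simp: var_term_def)

lemma defpred_False: "defpred \<MM> (\<lambda>e. False)"
  using defpred_not[OF defpred_True] by simp

lemma defpred_finite_ball:
  "finite I \<Longrightarrow> (\<And>i. i \<in> I \<Longrightarrow> defpred \<MM> (P i)) \<Longrightarrow> defpred \<MM> (\<lambda>e. \<forall>i\<in>I. P i e)"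
  by (induction I rule: finite_induct) (auto intro: defpred_conj defpred_True)

lemma defpred_all_less:
  "(\<And>i. i < n \<Longrightarrow> defpred \<MM> (P i)) \<Longrightarrow> defpred \<MM> (\<lambda>e. \<forall>i<n::nat. P i e)"
  using defpred_finite_ball[OF finite_lessThan, of n \<MM> P] by (simp add: Ball_def)

lemma defpred_iff_const:
  "defpred \<MM> P \<Longrightarrow> defpred \<MM> (\<lambda>e. P e \<longleftrightarrow> b)"
  by (cases b) (auto intro: defpred_not)

section \<open>Terms selecting variables, and their substitution\<close>

lemma tuple_term_seg: "tuple_term n (seg k n)"
  by (auto simp: tuple_term_def seg_def)

lemma tuple_term_seg_term:
  assumes "tuple_term N t" "k + n \<le> N" shows "tuple_term n (\<lambda>e. seg k n (t e))"
proof -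
  obtain g where "\<forall>e. t e = (\<lambda>i\<in>{..<N}. e (g i))" using assms(1) unfolding tuple_term_def by (elim exE) (rule that)
  then show ?thesis
    using assms(2) unfolding tuple_term_def
    by (intro exI[of _ "\<lambda>i. g (k + i)"]) (auto simp: seg_def fun_eq_iff)
qed

lemma tuple_term_join:
  assumes "tuple_term n t" "tuple_term m s"
  shows "tuple_term (n + m) (\<lambda>e. tuple_join n m (t e) (s e))"
proof -
  obtain g h where "\<forall>e. t e = (\<lambda>i\<in>{..<n}. e (g i))" "\<forall>e. s e = (\<lambda>i\<in>{..<m}. e (h i))"
    using assms unfolding tuple_term_def by (elim exE) (rule that)
  then show ?thesis
    unfolding tuple_term_def
    by (intro exI[of _ "\<lambda>i. if i < n then g i else h (i - n)"]) (auto simp: tuple_join_def fun_eq_iff)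
qed

lemma tuple_term_snoc:
  assumes "tuple_term m t" "var_term v"
  shows "tuple_term (Suc m) (\<lambda>e. (t e)(m := v e))"
proof -
  obtain g j where "\<forall>e. t e = (\<lambda>i\<in>{..<m}. e (g i))" "\<forall>e. v e = e j"
    using assms(1,2) unfolding tuple_term_def var_term_def by (elim exE) (rule that)
  then show ?thesis
    unfolding tuple_term_def
    by (intro exI[of _ "g(m := j)"]) (auto simp: fun_eq_iff)
qed

lemma tuple_term_upd:
  assumes "tuple_term m t" "var_term v" "i < m"
  shows "tuple_term m (\<lambda>e. (t e)(i := v e))"
proof -
  obtain g j where "\<forall>e. t e = (\<lambda>i\<in>{..<m}. e (g i))" "\<forall>e. v e = e j"
    using assms(1,2) unfolding tuple_term_def var_term_def by (elim exE) (rule that)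
  then show ?thesis
    using assms(3) unfolding tuple_term_def
    by (intro exI[of _ "g(i := j)"]) (auto simp: fun_eq_iff)
qed

lemma tuple_term_restrict:
  "(\<And>i. i < n \<Longrightarrow> var_term (t i)) \<Longrightarrow> tuple_term n (\<lambda>e. \<lambda>i\<in>{..<n}. t i e)"
proof -
  assume "\<And>i. i < n \<Longrightarrow> var_term (t i)"
  then obtain g where "\<And>i. i < n \<Longrightarrow> \<forall>e. t i e = e (g i)"
    unfolding var_term_def by metis
  then show ?thesis
    unfolding tuple_term_def by (intro exI[of _ g]) auto
qed

lemma var_term_env: "var_term (\<lambda>e. e i)"
  by (auto simp: var_term_def)

lemma var_term_nth: "tuple_term n t \<Longrightarrow> i < n \<Longrightarrow> var_term (\<lambda>e. t e i)"
  by (auto simp: tuple_term_def var_term_def)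

lemma tuple_term_shift: "tuple_term n t \<Longrightarrow> tuple_term n (\<lambda>e. t (shift m e))"
  unfolding tuple_term_def shift_def
proof (elim exE)
  fix g assume "\<forall>e. t e = (\<lambda>i\<in>{..<n}. e (g i))"
  then show "\<exists>g. \<forall>e. t (\<lambda>i. e (m + i)) = (\<lambda>i\<in>{..<n}. e (g i))"
    by (intro exI[of _ "\<lambda>i. m + g i"]) simp
qed

lemma tuple_term_in_tuples:
  "tuple_term n t \<Longrightarrow> (\<And>i. e i \<in> M) \<Longrightarrow> t e \<in> tuples M n"
  by (auto simp: tuple_term_def PiE_iff extensional_def)

lemma defset_app:
  assumes "defset \<MM> n X" "tuple_term n t" shows "defpred \<MM> (\<lambda>e. t e \<in> X)"
proof -
  obtain g where "\<forall>e. t e = (\<lambda>i\<in>{..<n}. e (g i))" using assms(2) unfolding tuple_term_def by (elim exE) (rule that)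
  then have "t e = seg 0 n (\<lambda>i. e (g i))" for e by (auto simp: seg_def)
  then show ?thesis
    using defpred_reindex[OF assms(1)[unfolded defset_def], of g] by simp
qed

lemma defrel_app:
  assumes "defrel \<MM> n q R" "tuple_term n t" "tuple_term q s"
  shows "defpred \<MM> (\<lambda>e. R (t e) (s e))"
proof -
  obtain g where "\<forall>e. tuple_join n q (t e) (s e) = (\<lambda>i\<in>{..<n + q}. e (g i))"
    using tuple_term_join[OF assms(2,3)] unfolding tuple_term_def by (elim exE) (rule that)
  then have *: "tuple_join n q (t e) (s e) = seg 0 (n + q) (\<lambda>i. e (g i))" for e
    by (auto simp: seg_def)
  have "t e \<in> tuples UNIV n" "s e \<in> tuples UNIV q" for e
    using assms(2,3) by (auto simp: tuple_term_def PiE_def extensional_def)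
  then have "t e = seg 0 n (tuple_join n q (t e) (s e))" "s e = seg n q (tuple_join n q (t e) (s e))" for e
    by (metis seg_tuple_join_left seg_tuple_join_right)+
  then have "t e = seg 0 n (\<lambda>i. e (g i))" "s e = seg n q (\<lambda>i. e (g i))" for e
    unfolding * by (auto simp: seg_def fun_eq_iff)
  then show ?thesis
    using defpred_reindex[OF assms(1)[unfolded defrel_def], of g] by simp
qed

section \<open>From \<open>definable\<close> and \<open>NIP\<close> to predicates on
  environments\<close>

lemma definable_imp_defset:
  assumes "definable \<MM> n X" shows "defset \<MM> n X"
proof -
  obtain \<phi> m c where *: "c \<in> tuples (universe \<MM>) m" "wf_fm \<MM> \<phi>" "fv \<phi> \<subseteq> {..<n + m}"
    "X = {x \<in> tuples (universe \<MM>) n. sat \<MM> (tuple_append n x c) \<phi>}"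
    using assms unfolding definable_def by (elim exE bexE conjE) (rule that)
  \<comment> \<open>\<open>definable\<close> puts the parameters behind the point,
    \<open>defset\<close> in front of it; \<open>f\<close> exchanges the two blocks.\<close>
  define f where "f i = (if i < n then m + i else i - n)" for i
  obtain \<psi> where \<psi>: "wf_fm \<MM> \<psi>" "\<forall>e. sat \<MM> e \<psi> = sat \<MM> (\<lambda>i. e (f i)) \<phi>"
    using sat_rename_exists[OF *(2)] by blast
  have "sat \<MM> (\<lambda>i. tuple_append m c e (f i)) \<phi> = sat \<MM> (tuple_append n (seg 0 n e) c) \<phi>" for e
    by (rule sat_cong) (use *(3) in \<open>auto simp: tuple_append_def seg_def f_def\<close>)
  then have "(seg 0 n e \<in> X) = sat \<MM> (tuple_append m c e) \<psi>" if "\<forall>i. e i \<in> universe \<MM>" for e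
    using that *(4) \<psi> by (simp add: seg_in_tuples)
  then show ?thesis
    unfolding defset_def by (rule defpredI[OF *(1) \<psi>(1)])
qed

lemma definable_subset: "definable \<MM> n X \<Longrightarrow> X \<subseteq> tuples (universe \<MM>) n"
  unfolding definable_def by blast

text \<open>\<open>NIP\<close> speaks of formulas without parameters, so the parameters of
  \<open>R\<close> become further entries of the second tuple. Every set shattered by
  \<open>R\<close> is then shattered by the resulting formula.\<close>

lemma NIP_defrel:
  assumes "NIP \<MM>" "defrel \<MM> p q R" "universe \<MM> \<noteq> {}"
  shows "\<exists>k. \<forall>A\<subseteq>tuples (universe \<MM>) p. finite A \<and> card A = k \<longrightarrow>
    \<not> (\<forall>S\<subseteq>A. \<exists>b\<in>tuples (universe \<MM>) q. \<forall>a\<in>A. R a b \<longleftrightarrow> a \<in> S)"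
proof -
  let ?M = "universe \<MM>"
  obtain u where u: "u \<in> ?M" using assms(3) by blast
  obtain \<phi> m c where *: "c \<in> tuples ?M m" "wf_fm \<MM> \<phi>"
    "\<And>e. \<forall>i. e i \<in> ?M \<Longrightarrow> R (seg 0 p e) (seg p q e) = sat \<MM> (tuple_append m c e) \<phi>"
    by (rule defpredE[OF assms(2)[unfolded defrel_def]]) (rule that)
  \<comment> \<open>\<open>defpred\<close> puts no bound on the free variables, so all indices past
    the two tuples are collapsed to the single \<open>p + q + m\<close>, which \<open>ext\<close>
    fills with \<open>u\<close>.\<close>
  define f where "f i = (if i < m then p + q + i else if i < m + p + q then i - m else p + q + m)" for i
  obtain \<psi> where \<psi>: "wf_fm \<MM> \<psi>" "fv \<psi> \<subseteq> f ` fv \<phi>" "\<forall>e. sat \<MM> e \<psi> = sat \<MM> (\<lambda>i. e (f i)) \<phi>"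
    using sat_rename_exists[OF *(2), of f] by blast
  have "f i < p + (q + m + 1)" for i by (auto simp: f_def)
  then have "fv \<psi> \<subseteq> {..<p + (q + m + 1)}" using \<psi>(2) by auto
  then have "\<not> has_IP \<MM> p (q + m + 1) \<psi>"
    using assms(1) \<psi>(1) unfolding NIP_def by simp
  then obtain k where k: "\<And>A. A \<subseteq> tuples ?M p \<Longrightarrow> finite A \<Longrightarrow> card A = k \<Longrightarrow> \<not> shatters \<MM> p (q + m + 1) \<psi> A"
    unfolding has_IP_def by auto
  define ext where "ext b = (\<lambda>i\<in>{..<q + m + 1}. if i < q then b i else if i < q + m then c (i - q) else u)" for b
  have ext: "ext b \<in> tuples ?M (q + m + 1)" if "b \<in> tuples ?M q" for b
    using that *(1) u by (auto simp: ext_def PiE_iff)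
  have R: "R a b = sat \<MM> (tuple_append p a (ext b)) \<psi>" if "a \<in> tuples ?M p" "b \<in> tuples ?M q" for a b
  proof -
    define e where "e i = (if i < p then a i else if i < p + q then b (i - p) else u)" for i
    have "\<forall>i. e i \<in> ?M" using that u by (auto simp: e_def)
    moreover have "seg 0 p e = a" "seg p q e = b"
      using that by (auto simp: seg_def e_def fun_eq_iff PiE_def extensional_def)
    moreover have "tuple_append m c e = (\<lambda>i. tuple_append p a (ext b) (f i))"
      by (auto simp: fun_eq_iff tuple_append_def e_def ext_def f_def)
    ultimately show ?thesis using *(3)[of e] \<psi>(3) by simp
  qed
  have "\<not> (\<forall>S\<subseteq>A. \<exists>b\<in>tuples ?M q. \<forall>a\<in>A. R a b \<longleftrightarrow> a \<in> S)"
    if A: "A \<subseteq> tuples ?M p" "finite A" "card A = k" for A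
  proof
    assume sh: "\<forall>S\<subseteq>A. \<exists>b\<in>tuples ?M q. \<forall>a\<in>A. R a b \<longleftrightarrow> a \<in> S"
    have "shatters \<MM> p (q + m + 1) \<psi> A"
      unfolding shatters_def
    proof (intro allI impI)
      fix S assume "S \<subseteq> A"
      then obtain b where b: "b \<in> tuples ?M q" "\<forall>a\<in>A. R a b \<longleftrightarrow> a \<in> S" using sh by blast
      have "\<forall>a\<in>A. sat \<MM> (tuple_append p a (ext b)) \<psi> \<longleftrightarrow> a \<in> S"
    proof
      fix a assume "a \<in> A"
      then show "sat \<MM> (tuple_append p a (ext b)) \<psi> \<longleftrightarrow> a \<in> S"
        using R[OF subsetD[OF A(1)] b(1)] b(2) by simp
    qed
      then show "\<exists>b\<in>tuples ?M (q + m + 1). \<forall>a\<in>A. sat \<MM> (tuple_append p a b) \<psi> \<longleftrightarrow> a \<in> S"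
        by (rule bexI[OF _ ext[OF b(1)]])
    qed
    then show False using k[OF A] by simp
  qed
  then show ?thesis by (intro exI[of _ k]) simp
qed

text \<open>These classical rules make the classical reasoner loop on \<open>x \<in> tuples M n\<close>.\<close>

declare PiE [rule del] PiE_E [rule del] PiE_I [rule del]

section \<open>Powers of a topological group\<close>

locale topological_group = group G for G :: "('a, 'b) monoid_scheme" (structure) +
  fixes T :: "'a topology"
  assumes group_topology: "group_topology G T"
begin

lemma topspace_T [simp]: "topspace T = carrier G"
  using group_topology by (simp add: group_topology_def)

definition nhd :: "'a set \<Rightarrow> bool" where
  "nhd V \<longleftrightarrow> openin T V \<and> \<one> \<in> V"

lemma nhd_carrier: "nhd (carrier G)"
  unfolding nhd_def using openin_topspace[of T] by simp

lemma nhd_Inter: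
  "finite I \<Longrightarrow> (\<And>i. i \<in> I \<Longrightarrow> nhd (V i)) \<Longrightarrow> \<exists>W. nhd W \<and> (\<forall>i\<in>I. W \<subseteq> V i)"
proof (induction I rule: finite_induct)
  case empty
  then show ?case using nhd_carrier by blast
next
  case (insert i I)
  then obtain W where "nhd W" "\<forall>i\<in>I. W \<subseteq> V i" by blast
  moreover have "nhd (V i)" using insert by blast
  ultimately have "nhd (W \<inter> V i) \<and> (\<forall>j\<in>insert i I. W \<inter> V i \<subseteq> V j)"
    by (auto simp: nhd_def)
  then show ?case by blast
qed

lemma continuous_mult:
  "continuous_map X T f \<Longrightarrow> continuous_map X T g \<Longrightarrow> continuous_map X T (\<lambda>x. f x \<otimes> g x)"
proof -
  assume "continuous_map X T f" "continuous_map X T g"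
  then have "continuous_map X (prod_topology T T) (\<lambda>x. (f x, g x))"
    by (simp add: continuous_map_paired)
  moreover have "continuous_map (prod_topology T T) T (\<lambda>(x, y). x \<otimes> y)"
    using group_topology by (simp add: group_topology_def)
  ultimately show ?thesis
    using continuous_map_compose by (fastforce simp: o_def)
qed

lemma continuous_inv:
  "continuous_map X T f \<Longrightarrow> continuous_map X T (\<lambda>x. inv (f x))"
proof -
  assume "continuous_map X T f"
  moreover have "continuous_map T T (\<lambda>x. inv x)"
    using group_topology by (simp add: group_topology_def)
  ultimately show ?thesis
    using continuous_map_compose by (fastforce simp: o_def)
qed

lemma nhd_continuous2:
  assumes "continuous_map (prod_topology T T) T (\<lambda>p. h (fst p) (snd p))" "h \<one> \<one> = \<one>" "nhd V"
  shows "\<exists>W. nhd W \<and> (\<forall>u\<in>W. \<forall>v\<in>W. h u v \<in> V)"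
proof -
  let ?S = "{p \<in> topspace (prod_topology T T). h (fst p) (snd p) \<in> V}"
  have open_S: "openin (prod_topology T T) ?S"
    using assms(3) by (intro openin_continuous_map_preimage[OF assms(1)]) (simp add: nhd_def)
  have one_S: "(\<one>, \<one>) \<in> ?S" using assms(2,3) by (simp add: nhd_def)
  obtain A B where AB: "openin T A" "openin T B" "\<one> \<in> A" "\<one> \<in> B" "A \<times> B \<subseteq> ?S"
    using open_S[unfolded openin_prod_topology_alt, rule_format, OF one_S] by (elim exE conjE) (rule that)
  then have "nhd (A \<inter> B)" by (auto simp: nhd_def)
  moreover have "\<forall>u\<in>A \<inter> B. \<forall>v\<in>A \<inter> B. h u v \<in> V" using AB(5) by auto
  ultimately show ?thesis by blast
qed

lemma nhd_mult:
  assumes "nhd V" shows "\<exists>W. nhd W \<and> (\<forall>u\<in>W. \<forall>v\<in>W. u \<otimes> v \<in> V)"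
  by (rule nhd_continuous2[OF _ _ assms],
      rule continuous_mult[OF continuous_map_fst continuous_map_snd]) simp

lemma nhd_inv_mult:
  assumes "nhd V" shows "\<exists>W. nhd W \<and> (\<forall>u\<in>W. \<forall>v\<in>W. inv u \<otimes> v \<in> V)"
  by (rule nhd_continuous2[OF _ _ assms],
      rule continuous_mult[OF continuous_inv[OF continuous_map_fst] continuous_map_snd]) simp

section \<open>The uniformity on powers, and thickenings of sets\<close>

text \<open>The translates \<open>V x\<close> of neighbourhoods of the identity, taken
  coordinatewise, give a uniformity. \<open>V\<close> need not be symmetric, so the order of
  \<open>x\<close> and \<open>y\<close> matters.\<close>

definition near :: "nat \<Rightarrow> 'a set \<Rightarrow> (nat \<Rightarrow> 'a) \<Rightarrow> (nat \<Rightarrow> 'a) \<Rightarrow> bool" where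
  "near n V x y \<longleftrightarrow> (\<forall>i<n. y i \<otimes> inv (x i) \<in> V)"

definition thicken :: "nat \<Rightarrow> 'a set \<Rightarrow> (nat \<Rightarrow> 'a) set \<Rightarrow> (nat \<Rightarrow> 'a) set" where
  "thicken n V C = {y \<in> tuples (carrier G) n. \<exists>x\<in>C. near n V x y}"

lemma near_mono: "near n V x y \<Longrightarrow> V \<subseteq> W \<Longrightarrow> near n W x y"
  by (auto simp: near_def)

lemma near_refl: "x \<in> tuples (carrier G) n \<Longrightarrow> nhd V \<Longrightarrow> near n V x x"
  by (auto simp: near_def nhd_def PiE_iff)

lemma openin_near:
  assumes "x \<in> tuples (carrier G) n" "nhd V"
  shows "openin (power_topology T n) {y \<in> tuples (carrier G) n. near n V x y}"
proof -
  have "openin T {z \<in> topspace T. z \<otimes> inv (x i) \<in> V}" if "i < n" for i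
  proof (rule openin_continuous_map_preimage)
    have "x i \<in> carrier G" using assms(1) that by (auto simp: PiE_iff)
    then show "continuous_map T T (\<lambda>z. z \<otimes> inv (x i))"
      by (intro continuous_mult) auto
  qed (use assms in \<open>simp add: nhd_def\<close>)
  moreover have "{y \<in> tuples (carrier G) n. near n V x y}
      = PiE {..<n} (\<lambda>i. {z \<in> topspace T. z \<otimes> inv (x i) \<in> V})"
    by (auto simp: near_def PiE_iff)
  ultimately show ?thesis by (simp add: openin_PiE)
qed

lemma openin_thicken:
  assumes "C \<subseteq> tuples (carrier G) n" "nhd V"
  shows "openin (power_topology T n) (thicken n V C)"
proof -
  have "thicken n V C = (\<Union>x\<in>C. {y \<in> tuples (carrier G) n. near n V x y})"
    by (auto simp: thicken_def)
  moreover have "openin (power_topology T n) {y \<in> tuples (carrier G) n. near n V x y}" if "x \<in> C" for x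
    using openin_near[OF subsetD[OF assms(1) that] assms(2)] .
  ultimately show ?thesis by (simp add: openin_clauses(3))
qed

lemma subset_thicken: "C \<subseteq> tuples (carrier G) n \<Longrightarrow> nhd V \<Longrightarrow> C \<subseteq> thicken n V C"
  using near_refl unfolding thicken_def by blast

lemma thicken_mono: "V \<subseteq> W \<Longrightarrow> thicken n V C \<subseteq> thicken n W C"
  using near_mono[of n V _ _ W] unfolding thicken_def by blast

text \<open>Translating the sides \<open>U i\<close> of a basic box around \<open>x\<close> back to
  the identity gives finitely many neighbourhoods, and \<open>V\<close> is chosen inside all of
  them.\<close>

lemma openin_power_near:
  assumes "openin (power_topology T n) W" "x \<in> W"
  shows "\<exists>V. nhd V \<and> (\<forall>y\<in>tuples (carrier G) n. near n V x y \<longrightarrow> y \<in> W)"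
proof -
  have x: "x \<in> tuples (carrier G) n"
    using assms(2) openin_subset[OF assms(1)] by auto
  obtain U where U: "\<forall>i\<in>{..<n}. openin T (U i)" "x \<in> PiE {..<n} U" "PiE {..<n} U \<subseteq> W"
    using assms(1)[unfolded openin_product_topology_alt, THEN bspec, OF assms(2)]
    by (elim exE conjE) (rule that)
  have "nhd {z \<in> topspace T. z \<otimes> x i \<in> U i}" if "i \<in> {..<n}" for i
  proof -
    have "x i \<in> carrier G" "x i \<in> U i" using x U(2) that by (auto simp: PiE_iff)
    moreover have "openin T {z \<in> topspace T. z \<otimes> x i \<in> U i}"
      using U(1) that calculation
      by (intro openin_continuous_map_preimage[where Y = T] continuous_mult) auto
    ultimately show ?thesis by (auto simp: nhd_def)
  qed
  then obtain V where V: "nhd V" "\<forall>i\<in>{..<n}. V \<subseteq> {z \<in> topspace T. z \<otimes> x i \<in> U i}"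
    using nhd_Inter[OF finite_lessThan, of n "\<lambda>i. {z \<in> topspace T. z \<otimes> x i \<in> U i}"] by blast
  have "y \<in> W" if y: "y \<in> tuples (carrier G) n" "near n V x y" for y
  proof -
    have "y i \<in> U i" if i: "i < n" for i
    proof -
      have "y i \<otimes> inv (x i) \<in> V" using y(2) i by (simp add: near_def)
      then have "y i \<otimes> inv (x i) \<otimes> x i \<in> U i" using V(2) i by auto
      moreover have "x i \<in> carrier G" "y i \<in> carrier G" using x y(1) i by (auto simp: PiE_iff)
      ultimately show ?thesis by (simp add: m_assoc)
    qed
    then have "y \<in> PiE {..<n} U" using y(1) by (auto simp: PiE_iff)
    then show ?thesis using U(3) by blast
  qed
  then show ?thesis using V(1) by blast
qed

lemma near_trans:
  assumes "\<forall>u\<in>V. \<forall>v\<in>V. u \<otimes> v \<in> W" "near n V x y" "near n V y z"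
    "x \<in> tuples (carrier G) n" "y \<in> tuples (carrier G) n" "z \<in> tuples (carrier G) n"
  shows "near n W x z"
  unfolding near_def
proof (intro allI impI)
  fix i assume i: "i < n"
  then have c: "x i \<in> carrier G" "y i \<in> carrier G" "z i \<in> carrier G"
    using assms(4-6) by (auto simp: PiE_iff)
  have "(z i \<otimes> inv (y i)) \<otimes> (y i \<otimes> inv (x i)) \<in> W"
    using assms(1-3) i by (simp add: near_def)
  moreover have "(z i \<otimes> inv (y i)) \<otimes> (y i \<otimes> inv (x i)) = z i \<otimes> inv (x i)"
    using c by (metis inv_closed inv_solve_left l_inv m_assoc m_closed r_one)
  ultimately show "z i \<otimes> inv (x i) \<in> W" by simp
qed

lemma near_cancel:
  assumes "\<forall>u\<in>V. \<forall>v\<in>V. inv u \<otimes> v \<in> W" "near n V x z" "near n V y z"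
    "x \<in> tuples (carrier G) n" "y \<in> tuples (carrier G) n" "z \<in> tuples (carrier G) n"
  shows "near n W x y"
  unfolding near_def
proof (intro allI impI)
  fix i assume i: "i < n"
  then have c: "x i \<in> carrier G" "y i \<in> carrier G" "z i \<in> carrier G"
    using assms(4-6) by (auto simp: PiE_iff)
  have "inv (z i \<otimes> inv (y i)) \<otimes> (z i \<otimes> inv (x i)) \<in> W"
    using assms(1-3) i by (simp add: near_def)
  moreover have "inv (z i \<otimes> inv (y i)) \<otimes> (z i \<otimes> inv (x i)) = y i \<otimes> inv (x i)"
    using c by (simp add: inv_mult_group m_assoc) (simp add: m_assoc[symmetric])
  ultimately show "y i \<otimes> inv (x i) \<in> W" by simp
qed

text \<open>If some \<open>y\<close> is close both to \<open>z\<close> and to a point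
  \<open>c\<close> of \<open>C\<close>, then \<open>c\<close> is close to \<open>z\<close>. How
  close is controlled by a \<open>V\<close> obtained from \<open>nhd_inv_mult\<close>.\<close>

lemma closed_separate_point:
  assumes "closedin (power_topology T n) C" "z \<in> tuples (carrier G) n" "z \<notin> C"
  shows "\<exists>V U. nhd V \<and> openin (power_topology T n) U \<and> z \<in> U \<and> U \<inter> thicken n V C = {}"
proof -
  have "openin (power_topology T n) (tuples (carrier G) n - C)"
    using assms(1) by (simp add: closedin_def)
  then obtain W where W: "nhd W" "\<forall>y\<in>tuples (carrier G) n. near n W z y \<longrightarrow> y \<notin> C"
    using openin_power_near[of n "tuples (carrier G) n - C" z] assms(2,3) by auto
  obtain V where V: "nhd V" "\<forall>u\<in>V. \<forall>v\<in>V. inv u \<otimes> v \<in> W"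
    using nhd_inv_mult[OF W(1)] by blast
  have C: "C \<subseteq> tuples (carrier G) n" using closedin_subset[OF assms(1)] by simp
  let ?U = "{y \<in> tuples (carrier G) n. near n V z y}"
  have "?U \<inter> thicken n V C = {}"
  proof (rule ccontr)
    assume "?U \<inter> thicken n V C \<noteq> {}"
    then obtain y c where "y \<in> tuples (carrier G) n" "near n V z y" "c \<in> C" "near n V c y"
      by (auto simp: thicken_def)
    then have "near n W z c"
      using near_cancel[OF V(2), of n z y c] subsetD[OF C] assms(2) by simp
    then show False using W(2) \<open>c \<in> C\<close> C by blast
  qed
  then show ?thesis
    using V(1) openin_near[OF assms(2) V(1)] near_refl[OF assms(2) V(1)] assms(2) by blast
qed

text \<open>A Lebesgue number argument: finitely many translates of the halved neighbourhoods
  \<open>V' x\<close> cover \<open>L\<close>, and any \<open>U\<close> inside all of these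
  \<open>V' x\<close> thickens \<open>L\<close> within \<open>W\<close>.\<close>

lemma compact_thicken_subset:
  assumes "compactin (power_topology T n) L" "openin (power_topology T n) W" "L \<subseteq> W"
  shows "\<exists>V. nhd V \<and> thicken n V L \<subseteq> W"
proof -
  have L: "L \<subseteq> tuples (carrier G) n" using compactin_subset_topspace[OF assms(1)] by simp
  have "\<exists>V V'. nhd V' \<and> (\<forall>u\<in>V'. \<forall>v\<in>V'. u \<otimes> v \<in> V) \<and>
      (\<forall>y\<in>tuples (carrier G) n. near n V x y \<longrightarrow> y \<in> W)" if "x \<in> L" for x
    using openin_power_near[OF assms(2), of x] nhd_mult that assms(3) by (meson subsetD)
  then obtain V V' where V: "\<And>x. x \<in> L \<Longrightarrow> nhd (V' x)"
    "\<And>x. x \<in> L \<Longrightarrow> \<forall>u\<in>V' x. \<forall>v\<in>V' x. u \<otimes> v \<in> V x"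
    "\<And>x. x \<in> L \<Longrightarrow> \<forall>y\<in>tuples (carrier G) n. near n (V x) x y \<longrightarrow> y \<in> W"
    by metis
  let ?N = "\<lambda>x. {y \<in> tuples (carrier G) n. near n (V' x) x y}"
  have "\<exists>\<F>. finite \<F> \<and> \<F> \<subseteq> ?N ` L \<and> L \<subseteq> \<Union>\<F>"
  proof (rule compactinD[OF assms(1)])
    show "openin (power_topology T n) U" if "U \<in> ?N ` L" for U
      using that openin_near[OF subsetD[OF L] V(1)] by (elim imageE) simp
    show "L \<subseteq> \<Union> (?N ` L)"
    proof
      fix x assume x: "x \<in> L"
      then have "x \<in> ?N x" using V(1) near_refl subsetD[OF L] by simp
      then show "x \<in> \<Union> (?N ` L)" using x by (rule UN_I[rotated])
    qed
  qed
  then obtain \<F> where \<F>: "finite \<F>" "\<F> \<subseteq> ?N ` L" "L \<subseteq> \<Union>\<F>"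
    by (elim exE conjE) (rule that)
  obtain F where "F \<subseteq> L" "finite F" "\<F> = ?N ` F"
    using finite_subset_image[OF \<F>(1,2)] by (elim exE conjE) (rule that)
  with \<F>(3) have F: "finite F" "F \<subseteq> L" "L \<subseteq> (\<Union>x\<in>F. ?N x)"
    by simp_all
  obtain U where U: "nhd U" "\<forall>x\<in>F. U \<subseteq> V' x"
    using nhd_Inter[OF F(1), of V'] V(1) F(2) by blast
  have "y \<in> W" if y: "y \<in> thicken n U L" for y
  proof -
    obtain l where l: "l \<in> L" "near n U l y" "y \<in> tuples (carrier G) n"
      using y by (auto simp: thicken_def)
    obtain x where x: "x \<in> F" "near n (V' x) x l" using F(3) l(1) by blast
    have "near n (V x) x y"
      using near_trans[OF V(2) x(2) near_mono[OF l(2)]] x(1) U(2) subsetD[OF F(2)] subsetD[OF L] l by simp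
    then show ?thesis using V(3) x(1) F(2) l(3) by blast
  qed
  then show ?thesis using U(1) by blast
qed

text \<open>Expresses the closure by quantifying over neighbourhoods of the identity; with a
  definable basis this becomes a first-order condition.\<close>

lemma closure_power_iff:
  assumes "C \<subseteq> tuples (carrier G) n" "y \<in> tuples (carrier G) n"
  shows "y \<in> power_topology T n closure_of C \<longleftrightarrow> (\<forall>V. nhd V \<longrightarrow> (\<exists>x\<in>C. near n V y x))"
proof
  assume "y \<in> power_topology T n closure_of C"
  then have cl: "\<exists>x. x \<in> C \<and> x \<in> W" if "y \<in> W" "openin (power_topology T n) W" for W
    using that unfolding in_closure_of by blast
  show "\<forall>V. nhd V \<longrightarrow> (\<exists>x\<in>C. near n V y x)"
    using cl[OF _ openin_near[OF assms(2)]] near_refl[OF assms(2)] assms(2) by blast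
next
  assume *: "\<forall>V. nhd V \<longrightarrow> (\<exists>x\<in>C. near n V y x)"
  have "\<exists>x. x \<in> C \<and> x \<in> W" if "y \<in> W" "openin (power_topology T n) W" for W
    using openin_power_near[OF that(2,1)] * assms(1) by blast
  then show "y \<in> power_topology T n closure_of C"
    using assms(2) by (simp add: in_closure_of)
qed

end

section \<open>Sets separated by a definable family\<close>

text \<open>The two definable families are unpacked into index sets \<open>BB\<close>,
  \<open>BK\<close> and total sets \<open>XB\<close>, \<open>XK\<close>, so that formulas can
  quantify over basic open sets and compact sets through their indices.\<close>

locale definable_topological_group = topological_group G T
  for G :: "('a, 'b) monoid_scheme" (structure) and T :: "'a topology" +
  fixes \<MM> :: "('f, 'r, 'a) fo_structure"
    and m\<^sub>B :: nat and BB XB :: "(nat \<Rightarrow> 'a) set"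
    and m\<^sub>K :: nat and BK XK :: "(nat \<Rightarrow> 'a) set"
  assumes expands: "expands_group \<MM> G"
    and hausdorff: "Hausdorff_space T"
    and BB: "BB \<subseteq> tuples (carrier G) m\<^sub>B" "defset \<MM> m\<^sub>B BB" "defset \<MM> (Suc m\<^sub>B) XB"
    and basis: "topology_basis T ((\<lambda>b. {x \<in> carrier G. b(m\<^sub>B := x) \<in> XB}) ` BB)"
    and BK: "BK \<subseteq> tuples (carrier G) m\<^sub>K" "defset \<MM> m\<^sub>K BK" "defset \<MM> (Suc m\<^sub>K) XK"
    and compact_BK: "\<And>c. c \<in> BK \<Longrightarrow> compactin T {x \<in> carrier G. c(m\<^sub>K := x) \<in> XK}"
    and cofinal_BK: "\<And>C. compactin T C \<Longrightarrow> \<exists>c\<in>BK. C \<subseteq> {x \<in> carrier G. c(m\<^sub>K := x) \<in> XK}"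
    and nip: "NIP \<MM>"
begin

lemma universe_eq [simp]: "universe \<MM> = carrier G"
  using expands by (simp add: expands_group_def)

lemmas defpred_bex_carrier = defpred_bex[of \<MM>, unfolded universe_eq]
  and defpred_bex_tuples = defpred_bex_tuple[of \<MM>, unfolded universe_eq]
  and defpred_ball_tuples = defpred_ball_tuple[of \<MM>, unfolded universe_eq]
  and defpred_const_tuple = defpred_const[of \<MM>, unfolded universe_eq]
  and defpred_cong_carrier = defpred_cong[of \<MM>, unfolded universe_eq]

lemma NIP_bound:
  assumes "defrel \<MM> p q R"
  obtains k where "\<And>A. A \<subseteq> tuples (carrier G) p \<Longrightarrow> finite A \<Longrightarrow> card A = k \<Longrightarrow>
      \<forall>S\<subseteq>A. \<exists>b\<in>tuples (carrier G) q. \<forall>a\<in>A. R a b \<longleftrightarrow> a \<in> S \<Longrightarrow> False"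
proof -
  have "universe \<MM> \<noteq> {}" using one_closed by auto
  from NIP_defrel[OF nip assms this] obtain k where
    k: "\<forall>A\<subseteq>tuples (carrier G) p. finite A \<and> card A = k \<longrightarrow>
      \<not> (\<forall>S\<subseteq>A. \<exists>b\<in>tuples (carrier G) q. \<forall>a\<in>A. R a b \<longleftrightarrow> a \<in> S)"
    unfolding universe_eq by (elim exE) (rule that)
  show thesis by (rule that[of k]) (use k in simp)
qed

definition bas :: "(nat \<Rightarrow> 'a) \<Rightarrow> 'a set" where
  "bas b = {v \<in> carrier G. b(m\<^sub>B := v) \<in> XB}"

definition nhd_indices :: "(nat \<Rightarrow> 'a) set" where
  "nhd_indices = {b \<in> BB. \<one> \<in> bas b}"

definition cpt :: "(nat \<Rightarrow> 'a) \<Rightarrow> 'a set" where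
  "cpt c = {x \<in> carrier G. c(m\<^sub>K := x) \<in> XK}"

lemma nhd_indices_subset: "nhd_indices \<subseteq> tuples (carrier G) m\<^sub>B"
  using BB(1) by (auto simp: nhd_indices_def)

lemma nhd_bas: "b \<in> nhd_indices \<Longrightarrow> nhd (bas b)"
proof -
  assume b: "b \<in> nhd_indices"
  then have "(arbitrary union_of (\<lambda>U. U \<in> (\<lambda>b. {x \<in> carrier G. b(m\<^sub>B := x) \<in> XB}) ` BB)) (bas b)"
    by (intro arbitrary_union_of_inc) (auto simp: nhd_indices_def bas_def)
  then show ?thesis
    using basis b unfolding topology_basis_def nhd_def nhd_indices_def by simp
qed

lemma nhd_contains_bas:
  assumes "nhd V" obtains b where "b \<in> nhd_indices" "bas b \<subseteq> V"
proof -
  have "(arbitrary union_of (\<lambda>U. U \<in> (\<lambda>b. {x \<in> carrier G. b(m\<^sub>B := x) \<in> XB}) ` BB)) V"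
    using basis assms unfolding topology_basis_def nhd_def by metis
  then obtain \<U> where "\<U> \<subseteq> (\<lambda>b. {x \<in> carrier G. b(m\<^sub>B := x) \<in> XB}) ` BB" "V = \<Union>\<U>"
    unfolding union_of_def by blast
  moreover have "\<one> \<in> V" using assms by (simp add: nhd_def)
  ultimately obtain b where "b \<in> BB" "\<one> \<in> bas b" "bas b \<subseteq> V"
    unfolding bas_def by blast
  then show thesis using that unfolding nhd_indices_def by blast
qed

lemma defset_nhd_indices: "defset \<MM> m\<^sub>B nhd_indices"
proof -
  \<comment> \<open>The identity enters as a parameter: \<open>d\<close> is a tuple of length one,
    later instantiated by \<open>\<one>\<close>.\<close>
  let ?Q = "\<lambda>d e. seg 0 m\<^sub>B e \<in> BB \<and> (seg 0 m\<^sub>B e)(m\<^sub>B := d 0) \<in> XB"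
  have "defpred \<MM> (\<lambda>e. seg 1 m\<^sub>B e \<in> BB \<and> (seg 1 m\<^sub>B e)(m\<^sub>B := e 0) \<in> XB)"
    by (intro defpred_conj defset_app[OF BB(2)] defset_app[OF BB(3)] tuple_term_snoc
        tuple_term_seg var_term_env)
  then have "defpred \<MM> (\<lambda>e. ?Q (seg 0 1 e) (shift 1 e))"
    by (simp add: seg_def)
  then have "defpred \<MM> (?Q (\<lambda>i\<in>{..<1::nat}. \<one>))"
    by (rule defpred_const_tuple) (simp add: PiE_iff extensional_def)
  then show ?thesis
    unfolding defset_def by (rule defpred_cong_carrier) (auto simp: nhd_indices_def bas_def)
qed

lemma defpred_mult:
  assumes "var_term u" "var_term v" "var_term w"
  shows "defpred \<MM> (\<lambda>e. u e \<otimes> v e = w e)"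
proof -
  obtain i j k where ijk: "\<forall>e. u e = e i" "\<forall>e. v e = e j" "\<forall>e. w e = e k"
    using assms unfolding var_term_def by (elim exE) (rule that)
  obtain f where f: "f \<in> funs \<MM>" "fun_arity \<MM> f = 2"
    "\<forall>x\<in>carrier G. \<forall>y\<in>carrier G. fun_interp \<MM> f (tuple_of_list [x, y]) = x \<otimes> y"
    using expands unfolding expands_group_def by blast
  show ?thesis
    by (rule defpredI[where c = "\<lambda>_. undefined" and m = 0 and \<phi> = "Equal (App f [Var i, Var j]) (Var k)"])
      (use f ijk in \<open>auto simp: tuple_append_def\<close>)
qed

text \<open>Only multiplication is given as a primitive, so the inverse is eliminated before
  definability is checked.\<close>

lemma mem_bas_iff:
  assumes "x \<in> carrier G" "y \<in> carrier G"
  shows "y \<otimes> inv x \<in> bas b \<longleftrightarrow> (\<exists>v\<in>carrier G. b(m\<^sub>B := v) \<in> XB \<and> v \<otimes> x = y)"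
proof
  assume "y \<otimes> inv x \<in> bas b"
  then show "\<exists>v\<in>carrier G. b(m\<^sub>B := v) \<in> XB \<and> v \<otimes> x = y"
    using assms by (intro bexI[of _ "y \<otimes> inv x"]) (simp_all add: bas_def m_assoc)
next
  assume "\<exists>v\<in>carrier G. b(m\<^sub>B := v) \<in> XB \<and> v \<otimes> x = y"
  then show "y \<otimes> inv x \<in> bas b"
    using assms by (auto simp: bas_def m_assoc)
qed

lemma defpred_near:
  assumes "tuple_term m\<^sub>B u" "tuple_term n t" "tuple_term n s"
  shows "defpred \<MM> (\<lambda>e. near n (bas (u e)) (t e) (s e))"
proof -
  have "defpred \<MM> (\<lambda>e. \<forall>i<n. \<exists>v\<in>carrier G. (u e)(m\<^sub>B := v) \<in> XB \<and> v \<otimes> t e i = s e i)"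
    by (intro defpred_all_less defpred_bex_carrier defpred_conj defset_app[OF BB(3)] tuple_term_snoc
        tuple_term_shift[OF assms(1)] defpred_mult var_term_env
        var_term_nth[OF tuple_term_shift[OF assms(2)]] var_term_nth[OF tuple_term_shift[OF assms(3)]])
  then show ?thesis
  proof (rule defpred_cong_carrier)
    fix e :: "nat \<Rightarrow> 'a" assume e: "\<And>i. e i \<in> carrier G"
    have "t e i \<in> carrier G \<and> s e i \<in> carrier G" if "i < n" for i
      using tuple_term_in_tuples[OF assms(2) e] tuple_term_in_tuples[OF assms(3) e] that
      by (auto simp: PiE_iff)
    then show "(\<forall>i<n. \<exists>v\<in>carrier G. (u e)(m\<^sub>B := v) \<in> XB \<and> v \<otimes> t e i = s e i)
        = near n (bas (u e)) (t e) (s e)"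
      by (auto simp: near_def mem_bas_iff)
  qed
qed

lemma defset_closure:
  assumes "defset \<MM> n C" "C \<subseteq> tuples (carrier G) n"
  shows "defset \<MM> n (power_topology T n closure_of C)"
proof -
  have "defpred \<MM> (\<lambda>e. \<forall>b\<in>tuples (carrier G) m\<^sub>B. b \<in> nhd_indices \<longrightarrow>
      (\<exists>x\<in>tuples (carrier G) n. x \<in> C \<and> near n (bas b) (seg 0 n e) x))"
    by (intro defpred_ball_tuples defpred_imp defpred_bex_tuples defpred_conj
        defset_app[OF defset_nhd_indices] defset_app[OF assms(1)] defpred_near)
      (simp_all add: tuple_term_seg)
  then show ?thesis
    unfolding defset_def
  proof (rule defpred_cong_carrier)
    fix e :: "nat \<Rightarrow> 'a" assume "\<And>i. e i \<in> carrier G"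
    then have y: "seg 0 n e \<in> tuples (carrier G) n" by (intro seg_in_tuples)
    have "(\<forall>V. nhd V \<longrightarrow> (\<exists>x\<in>C. near n V (seg 0 n e) x))
      \<longleftrightarrow> (\<forall>b\<in>nhd_indices. \<exists>x\<in>C. near n (bas b) (seg 0 n e) x)"
    proof (intro iffI allI ballI impI)
      fix V assume *: "\<forall>b\<in>nhd_indices. \<exists>x\<in>C. near n (bas b) (seg 0 n e) x" and "nhd V"
      obtain b where "b \<in> nhd_indices" "bas b \<subseteq> V" using nhd_contains_bas[OF \<open>nhd V\<close>] .
      then show "\<exists>x\<in>C. near n V (seg 0 n e) x" using * near_mono by blast
    qed (use nhd_bas in blast)
    then show "(\<forall>b\<in>tuples (carrier G) m\<^sub>B. b \<in> nhd_indices \<longrightarrow>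
      (\<exists>x\<in>tuples (carrier G) n. x \<in> C \<and> near n (bas b) (seg 0 n e) x))
      = (seg 0 n e \<in> power_topology T n closure_of C)"
      using closure_power_iff[OF assms(2) y] nhd_indices_subset assms(2) by blast
  qed
qed

section \<open>Externally definable sets and their Boolean combinations\<close>

text \<open>Open sets are required so that the separation is stable under moving the points:
  \<open>ext_def_noiseless\<close> splits open cells by it, and \<open>ext_def_imp_honest\<close>
  replaces a point of a closure by a nearby one.\<close>

definition separates ::
  "nat \<Rightarrow> ((nat \<Rightarrow> 'a) \<Rightarrow> bool) \<Rightarrow> (nat \<Rightarrow> 'a) set \<Rightarrow> (nat \<Rightarrow> 'a) set \<Rightarrow> bool" where
  "separates n P F F' \<longleftrightarrow>
     (\<exists>U U'. openin (power_topology T n) U \<and> openin (power_topology T n) U' \<and> F \<subseteq> U \<and> F' \<subseteq> U' \<and>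
        (\<forall>x\<in>U. P x) \<and> (\<forall>x\<in>U'. \<not> P x))"

text \<open>
  The counterpart, inside the group itself, of an externally definable subset of a saturated
  extension that is a union of fibres of the standard part map.
\<close>

definition ext_def :: "nat \<Rightarrow> (nat \<Rightarrow> 'a) set \<Rightarrow> bool" where
  "ext_def n A \<longleftrightarrow> A \<subseteq> tuples (carrier G) n \<and>
     (\<exists>q R. defrel \<MM> n q R \<and>
        (\<forall>F F'. finite F \<longrightarrow> finite F' \<longrightarrow> F \<subseteq> A \<longrightarrow> F' \<subseteq> tuples (carrier G) n - A \<longrightarrow>
           (\<exists>b\<in>tuples (carrier G) q. separates n (\<lambda>x. R x b) F F')))"

lemma ext_defE:
  assumes "ext_def n A"
  obtains q R where "A \<subseteq> tuples (carrier G) n" "defrel \<MM> n q R"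
    "\<And>F F'. finite F \<Longrightarrow> finite F' \<Longrightarrow> F \<subseteq> A \<Longrightarrow> F' \<subseteq> tuples (carrier G) n - A \<Longrightarrow>
       \<exists>b\<in>tuples (carrier G) q. separates n (\<lambda>x. R x b) F F'"
proof -
  from assms obtain q R where *: "A \<subseteq> tuples (carrier G) n" "defrel \<MM> n q R"
    "\<forall>F F'. finite F \<longrightarrow> finite F' \<longrightarrow> F \<subseteq> A \<longrightarrow> F' \<subseteq> tuples (carrier G) n - A \<longrightarrow>
       (\<exists>b\<in>tuples (carrier G) q. separates n (\<lambda>x. R x b) F F')"
    unfolding ext_def_def by (elim exE conjE) (rule that)
  show thesis by (rule that[OF *(1,2)]) (rule *(3)[rule_format])
qed

lemma ext_defI:
  assumes "A \<subseteq> tuples (carrier G) n" "defrel \<MM> n q R"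
    "\<And>F F'. finite F \<Longrightarrow> finite F' \<Longrightarrow> F \<subseteq> A \<Longrightarrow> F' \<subseteq> tuples (carrier G) n - A \<Longrightarrow>
       \<exists>b\<in>tuples (carrier G) q. separates n (\<lambda>x. R x b) F F'"
  shows "ext_def n A"
  unfolding ext_def_def
  by (rule conjI[OF assms(1)], rule exI[of _ q], rule exI[of _ R]) (use assms in simp)

lemma ext_def_closed:
  assumes "closedin (power_topology T n) C" "defset \<MM> n C"
  shows "ext_def n C"
proof (rule ext_defI)
  show C: "C \<subseteq> tuples (carrier G) n" using closedin_subset[OF assms(1)] by simp
  let ?R = "\<lambda>x b. b \<in> nhd_indices \<and> (\<exists>c\<in>tuples (carrier G) n. c \<in> C \<and> near n (bas b) c x)"
  show "defrel \<MM> n m\<^sub>B ?R"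
    unfolding defrel_def
    by (intro defpred_bex_tuples defpred_conj
        defset_app[OF defset_nhd_indices] defset_app[OF assms(2)] defpred_near)
      (simp_all add: tuple_term_seg)
  fix F F' assume fin: "finite F" "finite F'" and F: "F \<subseteq> C" and F': "F' \<subseteq> tuples (carrier G) n - C"
  have "\<forall>z\<in>F'. \<exists>V U. nhd V \<and> openin (power_topology T n) U \<and> z \<in> U \<and> U \<inter> thicken n V C = {}"
    using closed_separate_point[OF assms(1)] F' by blast
  then obtain V U where VU: "\<And>z. z \<in> F' \<Longrightarrow> nhd (V z)" "\<And>z. z \<in> F' \<Longrightarrow> openin (power_topology T n) (U z)"
    "\<And>z. z \<in> F' \<Longrightarrow> z \<in> U z" "\<And>z. z \<in> F' \<Longrightarrow> U z \<inter> thicken n (V z) C = {}"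
    by metis
  \<comment> \<open>Finiteness of \<open>F'\<close> enters here: one neighbourhood works for all its
    points.\<close>
  obtain V' where V': "nhd V'" "\<forall>z\<in>F'. V' \<subseteq> V z"
    using nhd_Inter[OF fin(2), of V] VU(1) by blast
  obtain b where b: "b \<in> nhd_indices" "bas b \<subseteq> V'" using nhd_contains_bas[OF V'(1)] .
  have R: "?R x b \<longleftrightarrow> x \<in> thicken n (bas b) C" if "x \<in> tuples (carrier G) n" for x
    using that b(1) C unfolding thicken_def by blast
  have "thicken n (bas b) C \<subseteq> thicken n (V z) C" if "z \<in> F'" for z
    using thicken_mono V'(2) b(2) that by (meson order_trans)
  then have disj: "U z \<inter> thicken n (bas b) C = {}" if "z \<in> F'" for z
    using VU(4)[OF that] that by blast
  have "separates n (\<lambda>x. ?R x b) F F'"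
    unfolding separates_def
  proof (intro exI conjI ballI)
    show 1: "openin (power_topology T n) (thicken n (bas b) C)"
      using openin_thicken[OF C nhd_bas[OF b(1)]] .
    show 2: "openin (power_topology T n) (\<Union>z\<in>F'. U z)"
      using VU(2) by (intro openin_clauses(3)) auto
    show "F \<subseteq> thicken n (bas b) C" using F subset_thicken[OF C nhd_bas[OF b(1)]] by blast
    show "F' \<subseteq> (\<Union>z\<in>F'. U z)" using VU(3) by blast
    fix x
    show "b \<in> nhd_indices" by (rule b(1))
    show "\<exists>c\<in>tuples (carrier G) n. c \<in> C \<and> near n (bas b) c x" if "x \<in> thicken n (bas b) C"
      using that C unfolding thicken_def by blast
    show "\<not> ?R x b" if x: "x \<in> (\<Union>z\<in>F'. U z)"
    proof -
      have "x \<in> tuples (carrier G) n" using x openin_subset[OF 2] by auto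
      moreover have "x \<notin> thicken n (bas b) C" using x disj by blast
      ultimately show ?thesis using R[of x] by simp
    qed
  qed
  then show "\<exists>b\<in>tuples (carrier G) m\<^sub>B. separates n (\<lambda>x. ?R x b) F F'"
    using b(1) nhd_indices_subset by blast
qed

lemma ext_def_compl:
  assumes "ext_def n A" shows "ext_def n (tuples (carrier G) n - A)"
proof -
  obtain q R where A: "A \<subseteq> tuples (carrier G) n" "defrel \<MM> n q R"
    "\<And>F F'. finite F \<Longrightarrow> finite F' \<Longrightarrow> F \<subseteq> A \<Longrightarrow> F' \<subseteq> tuples (carrier G) n - A \<Longrightarrow>
       \<exists>b\<in>tuples (carrier G) q. separates n (\<lambda>x. R x b) F F'"
    by (rule ext_defE[OF assms]) (rule that)
  show ?thesis
  proof (rule ext_defI[of _ _ q "\<lambda>x b. \<not> R x b"])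
    show "defrel \<MM> n q (\<lambda>x b. \<not> R x b)"
      using A(2) unfolding defrel_def by (rule defpred_not)
    fix F F' assume "finite F" "finite F'" "F \<subseteq> tuples (carrier G) n - A"
      "F' \<subseteq> tuples (carrier G) n - (tuples (carrier G) n - A)"
    then obtain b where "b \<in> tuples (carrier G) q" "separates n (\<lambda>x. R x b) F' F"
      using A(3)[of F' F] by blast
    then show "\<exists>b\<in>tuples (carrier G) q. separates n (\<lambda>x. \<not> R x b) F F'"
      unfolding separates_def by blast
  qed blast
qed

lemma ext_def_Int:
  assumes "ext_def n A" "ext_def n B" shows "ext_def n (A \<inter> B)"
proof -
  obtain q R where A: "A \<subseteq> tuples (carrier G) n" "defrel \<MM> n q R"
    "\<And>F F'. finite F \<Longrightarrow> finite F' \<Longrightarrow> F \<subseteq> A \<Longrightarrow> F' \<subseteq> tuples (carrier G) n - A \<Longrightarrow>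
       \<exists>b\<in>tuples (carrier G) q. separates n (\<lambda>x. R x b) F F'"
    by (rule ext_defE[OF assms(1)]) (rule that)
  obtain q' R' where B: "B \<subseteq> tuples (carrier G) n" "defrel \<MM> n q' R'"
    "\<And>F F'. finite F \<Longrightarrow> finite F' \<Longrightarrow> F \<subseteq> B \<Longrightarrow> F' \<subseteq> tuples (carrier G) n - B \<Longrightarrow>
       \<exists>b\<in>tuples (carrier G) q'. separates n (\<lambda>x. R' x b) F F'"
    by (rule ext_defE[OF assms(2)]) (rule that)
  let ?R = "\<lambda>x b. R x (seg 0 q b) \<and> R' x (seg q q' b)"
  show ?thesis
  proof (rule ext_defI)
    show "A \<inter> B \<subseteq> tuples (carrier G) n" using A(1) by blast
    show "defrel \<MM> n (q + q') ?R"
      unfolding defrel_def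
      by (intro defpred_conj defrel_app[OF A(2)] defrel_app[OF B(2)] tuple_term_seg
          tuple_term_seg_term[OF tuple_term_seg]) auto
    fix F F' assume F: "finite F" "finite F'" "F \<subseteq> A \<inter> B" "F' \<subseteq> tuples (carrier G) n - A \<inter> B"
    \<comment> \<open>A point of \<open>F'\<close> is outside \<open>A\<close> or outside
      \<open>B\<close>, and it suffices that the corresponding relation rejects it; both relations
      must accept \<open>F\<close>.\<close>
    obtain b where b: "b \<in> tuples (carrier G) q" "separates n (\<lambda>x. R x b) F (F' - A)"
      using A(3)[of F "F' - A"] F by blast
    obtain b' where b': "b' \<in> tuples (carrier G) q'" "separates n (\<lambda>x. R' x b') F (F' - B)"
      using B(3)[of F "F' - B"] F by blast
    obtain U V where U: "openin (power_topology T n) U" "openin (power_topology T n) V"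
      "F \<subseteq> U" "F' - A \<subseteq> V" "\<forall>x\<in>U. R x b" "\<forall>x\<in>V. \<not> R x b"
      using b(2) unfolding separates_def by blast
    obtain U' V' where U': "openin (power_topology T n) U'" "openin (power_topology T n) V'"
      "F \<subseteq> U'" "F' - B \<subseteq> V'" "\<forall>x\<in>U'. R' x b'" "\<forall>x\<in>V'. \<not> R' x b'"
      using b'(2) unfolding separates_def by blast
    have "separates n (\<lambda>x. R x b \<and> R' x b') F F'"
      unfolding separates_def
    proof (intro exI conjI)
      show "openin (power_topology T n) (U \<inter> U')" "openin (power_topology T n) (V \<union> V')"
        using U U' by auto
      show "F' \<subseteq> V \<union> V'" using U(4) U'(4) F(4) by blast
    qed (use U U' in blast)+
    then show "\<exists>b\<in>tuples (carrier G) (q + q'). separates n (\<lambda>x. ?R x b) F F'"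
      by (intro bexI[of _ "tuple_join q q' b b'"])
        (simp_all add: seg_tuple_join_left[OF b(1)] seg_tuple_join_right[OF b'(1)]
          tuple_join_in_tuples[OF b(1) b'(1)])
  qed
qed

text \<open>The last premise expresses definability of \<open>f\<close> by its effect on families;
  \<open>ext_def_fibre\<close> supplies it for the map that appends fixed parameters.\<close>

lemma ext_def_preimage:
  assumes "ext_def k A" "continuous_map (power_topology T n) (power_topology T k) f"
    and "\<And>q R. defrel \<MM> k q R \<Longrightarrow> defrel \<MM> n q (\<lambda>x. R (f x))"
  shows "ext_def n {x \<in> tuples (carrier G) n. f x \<in> A}"
proof -
  obtain q R where A: "A \<subseteq> tuples (carrier G) k" "defrel \<MM> k q R"
    "\<And>F F'. finite F \<Longrightarrow> finite F' \<Longrightarrow> F \<subseteq> A \<Longrightarrow> F' \<subseteq> tuples (carrier G) k - A \<Longrightarrow>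
       \<exists>b\<in>tuples (carrier G) q. separates k (\<lambda>x. R x b) F F'"
    by (rule ext_defE[OF assms(1)]) (rule that)
  have f: "f x \<in> tuples (carrier G) k" if "x \<in> tuples (carrier G) n" for x
    using assms(2) that unfolding continuous_map_def Pi_def by simp
  show ?thesis
  proof (rule ext_defI[OF _ assms(3)[OF A(2)]])
    fix F F' assume F: "finite F" "finite F'" "F \<subseteq> {x \<in> tuples (carrier G) n. f x \<in> A}"
      "F' \<subseteq> tuples (carrier G) n - {x \<in> tuples (carrier G) n. f x \<in> A}"
    then have "f ` F \<subseteq> A" "f ` F' \<subseteq> tuples (carrier G) k - A" using f by blast+
    then obtain b where b: "b \<in> tuples (carrier G) q" "separates k (\<lambda>x. R x b) (f ` F) (f ` F')"
      using A(3)[of "f ` F" "f ` F'"] F(1,2) by blast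
    obtain U V where U: "openin (power_topology T k) U" "openin (power_topology T k) V"
      "f ` F \<subseteq> U" "f ` F' \<subseteq> V" "\<forall>x\<in>U. R x b" "\<forall>x\<in>V. \<not> R x b"
      using b(2) unfolding separates_def by blast
    have "separates n (\<lambda>x. R (f x) b) F F'"
      unfolding separates_def
    proof (intro exI conjI)
      show "openin (power_topology T n) {x \<in> topspace (power_topology T n). f x \<in> U}"
        "openin (power_topology T n) {x \<in> topspace (power_topology T n). f x \<in> V}"
        using U openin_continuous_map_preimage[OF assms(2)] by blast+
    qed (use U F(3,4) in auto)
    then show "\<exists>b\<in>tuples (carrier G) q. separates n (\<lambda>x. R (f x) b) F F'"
      using b(1) by blast
  qed blast
qed

section \<open>Noiselessness of externally definable sets\<close>

text \<open>Otherwise \<open>X\<close> and its complement are both dense in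
  \<open>N \<inter> Y\<close> for some open \<open>N\<close> meeting \<open>Y\<close>. Repeated
  splitting yields, for each \<open>k\<close>, indices \<open>b i\<close> such that points of the
  power realise every pattern of \<open>R x (b i)\<close>; NIP is contradicted with the roles of
  points and indices exchanged.\<close>

lemma ext_def_noiseless:
  assumes "ext_def n X"
  shows "nowhere_dense_in (power_topology T n) X Y \<or> has_interior_in (power_topology T n) X Y"
proof (rule ccontr)
  let ?P = "power_topology T n"
  assume "\<not> ?thesis"
  then have nwd: "subtopology ?P Y interior_of (subtopology ?P Y closure_of (X \<inter> Y)) \<noteq> {}"
    and int: "subtopology ?P Y interior_of (X \<inter> Y) = {}"
    by (simp_all add: nowhere_dense_in_def has_interior_in_def)
  obtain N where N: "openin ?P N" "N \<inter> Y \<noteq> {}" "N \<inter> Y \<subseteq> subtopology ?P Y closure_of (X \<inter> Y)"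
    using nwd unfolding interior_of_def openin_subtopology by blast
  obtain q R where X: "X \<subseteq> tuples (carrier G) n" "defrel \<MM> n q R"
    "\<And>F F'. finite F \<Longrightarrow> finite F' \<Longrightarrow> F \<subseteq> X \<Longrightarrow> F' \<subseteq> tuples (carrier G) n - X \<Longrightarrow>
       \<exists>b\<in>tuples (carrier G) q. separates n (\<lambda>x. R x b) F F'"
    by (rule ext_defE[OF assms]) (rule that)
  define big where "big V \<longleftrightarrow> openin ?P V \<and> V \<subseteq> N \<and> V \<inter> Y \<noteq> {}" for V
  have big_subset: "V \<subseteq> tuples (carrier G) n" if "big V" for V
    using that openin_subset[of ?P V] by (simp add: big_def)
  have dense: "\<exists>x. x \<in> V \<and> x \<in> Y \<and> x \<in> X" if "big V" for V
  proof -
    obtain y where y: "y \<in> V" "y \<in> Y" "y \<in> N" using \<open>big V\<close> by (auto simp: big_def)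
    then have "y \<in> subtopology ?P Y closure_of (X \<inter> Y)" using N(3) by blast
    moreover have "openin (subtopology ?P Y) (V \<inter> Y)"
      using \<open>big V\<close> unfolding openin_subtopology big_def by blast
    ultimately obtain z where "z \<in> X \<inter> Y" "z \<in> V \<inter> Y"
      using y unfolding in_closure_of by blast
    then show ?thesis by blast
  qed
  have codense: "\<exists>x. x \<in> V \<and> x \<in> Y \<and> x \<notin> X" if "big V" for V
  proof (rule ccontr)
    assume "\<not> ?thesis"
    then have "V \<inter> Y \<subseteq> X \<inter> Y" by blast
    moreover have "openin (subtopology ?P Y) (V \<inter> Y)"
      using \<open>big V\<close> unfolding openin_subtopology big_def by blast
    ultimately have "V \<inter> Y \<subseteq> subtopology ?P Y interior_of (X \<inter> Y)"
      by (rule interior_of_maximal)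
    then show False using int \<open>big V\<close> by (simp add: big_def)
  qed
  \<comment> \<open>The \<open>V S\<close> are open sets inside the cells of a Venn diagram of
    \<open>k\<close> members of the family, and each of them still meets \<open>Y\<close>.\<close>
  have ind: "\<exists>b V. (\<forall>i<k. b i \<in> tuples (carrier G) q) \<and>
      (\<forall>S\<subseteq>{..<k}. big (V S) \<and> (\<forall>i<k. \<forall>x\<in>V S. R x (b i) \<longleftrightarrow> i \<in> S))" for k :: nat
  proof (induction k)
    case 0
    have "big N" using N by (simp add: big_def)
    then show ?case by auto
  next
    case (Suc k)
    then obtain b V where *: "\<forall>i<k. b i \<in> tuples (carrier G) q"
      "\<forall>S\<subseteq>{..<k}. big (V S) \<and> (\<forall>i<k. \<forall>x\<in>V S. R x (b i) \<longleftrightarrow> i \<in> S)"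
      by (elim exE conjE) (rule that)
    have b: "\<And>i. i < k \<Longrightarrow> b i \<in> tuples (carrier G) q"
      and big: "\<And>S. S \<subseteq> {..<k} \<Longrightarrow> big (V S)"
      and V: "\<And>S i x. S \<subseteq> {..<k} \<Longrightarrow> i < k \<Longrightarrow> x \<in> V S \<Longrightarrow> R x (b i) \<longleftrightarrow> i \<in> S"
      using * by simp_all
    \<comment> \<open>One point inside and one outside \<open>X\<close> are chosen in every cell, so
      a single new index \<open>c\<close> splits all cells at once.\<close>
    have "\<forall>S\<in>Pow {..<k}. \<exists>x y. x \<in> V S \<and> x \<in> Y \<and> x \<in> X \<and> y \<in> V S \<and> y \<in> Y \<and> y \<notin> X"
      using dense codense big by blast
    then obtain x y where xy: "\<And>S. S \<subseteq> {..<k} \<Longrightarrow> x S \<in> V S \<and> x S \<in> Y \<and> x S \<in> X"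
      "\<And>S. S \<subseteq> {..<k} \<Longrightarrow> y S \<in> V S \<and> y S \<in> Y \<and> y S \<notin> X"
      by (metis PowI)
    have "x ` Pow {..<k} \<subseteq> X" using xy by blast
    moreover have "y ` Pow {..<k} \<subseteq> tuples (carrier G) n - X"
      using xy(2) big_subset[OF big] by blast
    ultimately obtain c where c: "c \<in> tuples (carrier G) q"
      "separates n (\<lambda>z. R z c) (x ` Pow {..<k}) (y ` Pow {..<k})"
      using X(3)[of "x ` Pow {..<k}" "y ` Pow {..<k}"] by auto
    obtain U U' where U: "openin ?P U" "openin ?P U'" "x ` Pow {..<k} \<subseteq> U" "y ` Pow {..<k} \<subseteq> U'"
      "\<forall>z\<in>U. R z c" "\<forall>z\<in>U'. \<not> R z c"
      using c(2) unfolding separates_def by blast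
    let ?b = "b(k := c)" and ?V = "\<lambda>S. V (S \<inter> {..<k}) \<inter> (if k \<in> S then U else U')"
    have "?b i \<in> tuples (carrier G) q" if "i < Suc k" for i
      using that b[of i] c(1) by (cases "i = k") simp_all
    moreover have "big (?V S) \<and> (\<forall>i<Suc k. \<forall>z\<in>?V S. R z (?b i) \<longleftrightarrow> i \<in> S)" for S
    proof
      let ?S = "S \<inter> {..<k}"
      have S: "?S \<in> Pow {..<k}" by simp
      have "x ?S \<in> U" "y ?S \<in> U'"
        by (rule subsetD[OF U(3) imageI[OF S]], rule subsetD[OF U(4) imageI[OF S]])
      moreover have "x ?S \<in> V ?S \<inter> Y" "y ?S \<in> V ?S \<inter> Y"
        using xy(1)[of ?S] xy(2)[of ?S] by simp_all
      moreover have "openin ?P (V ?S)" "V ?S \<subseteq> N" using big[of ?S] by (simp_all add: big_def)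
      ultimately show "big (?V S)"
        using U(1,2) unfolding big_def 
        by (cases "k \<in> S") (simp_all add: openin_Int le_infI1 disjoint_iff, metis, metis)
      show "\<forall>i<Suc k. \<forall>z\<in>?V S. R z (?b i) \<longleftrightarrow> i \<in> S"
      proof (intro allI impI ballI)
        fix i z assume i: "i < Suc k" and z: "z \<in> ?V S"
        show "R z (?b i) \<longleftrightarrow> i \<in> S"
        proof (cases "i = k")
          case True
          then show ?thesis using z U(5,6) by (cases "k \<in> S") simp_all
        next
          case False
          then show ?thesis using z i V[of ?S i z] by simp
        qed
      qed
    qed
    ultimately show ?case
      by (intro exI[of _ ?b] exI[of _ ?V]) simp
  qed
  have "defrel \<MM> q n (\<lambda>b x. R x b)"
    unfolding defrel_def by (intro defrel_app[OF X(2)] tuple_term_seg)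
  then obtain k where k: "\<And>A. A \<subseteq> tuples (carrier G) q \<Longrightarrow> finite A \<Longrightarrow> card A = k \<Longrightarrow>
      \<forall>S\<subseteq>A. \<exists>x\<in>tuples (carrier G) n. \<forall>b\<in>A. R x b \<longleftrightarrow> b \<in> S \<Longrightarrow> False"
    by (rule NIP_bound) (rule that)
  obtain b V where *: "\<forall>i<k. b i \<in> tuples (carrier G) q"
    "\<forall>S\<subseteq>{..<k}. big (V S) \<and> (\<forall>i<k. \<forall>x\<in>V S. R x (b i) \<longleftrightarrow> i \<in> S)"
    using ind[of k] by (elim exE conjE) (rule that)
  have b: "\<And>i. i < k \<Longrightarrow> b i \<in> tuples (carrier G) q"
    and big: "\<And>S. S \<subseteq> {..<k} \<Longrightarrow> big (V S)"
    and V: "\<And>S i x. S \<subseteq> {..<k} \<Longrightarrow> i < k \<Longrightarrow> x \<in> V S \<Longrightarrow> R x (b i) \<longleftrightarrow> i \<in> S"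
    using * by simp_all
  have point: "\<exists>x\<in>tuples (carrier G) n. x \<in> V S" if "S \<subseteq> {..<k}" for S
    using big[OF that] big_subset[OF big[OF that]] unfolding big_def by blast
  have "inj_on b {..<k}"
  proof (rule inj_onI)
    fix i j assume ij: "i \<in> {..<k}" "j \<in> {..<k}" "b i = b j"
    obtain x where "x \<in> V {i}" using point[of "{i}"] ij(1) by blast
    then show "i = j" using V[of "{i}" i x] V[of "{i}" j x] ij by auto
  qed
  then have "card (b ` {..<k}) = k" by (simp add: card_image)
  moreover have "\<exists>x\<in>tuples (carrier G) n. \<forall>c\<in>b ` {..<k}. R x c \<longleftrightarrow> c \<in> S" if "S \<subseteq> b ` {..<k}" for S
  proof -
    let ?S = "{i \<in> {..<k}. b i \<in> S}"
    obtain x where x: "x \<in> tuples (carrier G) n" "x \<in> V ?S" using point[of ?S] by blast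
    have "R x (b i) \<longleftrightarrow> b i \<in> S" if "i < k" for i using V[of ?S i x] x(2) that by auto
    then show ?thesis using x(1) by (intro bexI[of _ x]) auto
  qed
  ultimately show False using k[of "b ` {..<k}"] b by (simp add: image_subset_iff)
qed

end

section \<open>Honest definitions\<close>

text \<open>Taking \<open>Z\<close> empty in the third clause shows that \<open>A\<close> itself is
  large, so only the trace of a set on \<open>A\<close> counts.\<close>

definition ultrafilter_on :: "'x set \<Rightarrow> ('x set \<Rightarrow> bool) \<Rightarrow> bool" where
  "ultrafilter_on A \<U> \<longleftrightarrow>
     (\<forall>Y Z. \<U> Y \<longrightarrow> Y \<subseteq> Z \<longrightarrow> \<U> Z) \<and> (\<forall>Y Z. \<U> Y \<longrightarrow> \<U> Z \<longrightarrow> \<U> (Y \<inter> Z)) \<and>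
     (\<forall>Z. \<U> Z \<or> \<U> (A - Z)) \<and> \<not> \<U> {}"

lemma ultrafilter_on_mono: "ultrafilter_on A \<U> \<Longrightarrow> \<U> Y \<Longrightarrow> Y \<subseteq> Z \<Longrightarrow> \<U> Z"
  by (simp add: ultrafilter_on_def)

text \<open>Zorn's lemma gives a maximal ideal \<open>J\<close> containing \<open>I\<close> but not
  \<open>A\<close>; maximality makes it prime, and the sets outside \<open>J\<close> are the large
  ones.\<close>

lemma ultrafilter_avoiding_ideal:
  assumes sub: "\<And>Y Z. Z \<in> I \<Longrightarrow> Y \<subseteq> Z \<Longrightarrow> Y \<in> I"
    and un: "\<And>Y Z. Y \<in> I \<Longrightarrow> Z \<in> I \<Longrightarrow> Y \<union> Z \<in> I"
    and empty: "{} \<in> I" and proper: "A \<notin> I"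
  obtains \<U> :: "'x set \<Rightarrow> bool" where "ultrafilter_on A \<U>" "\<And>Z. \<U> Z \<Longrightarrow> Z \<notin> I"
proof -
  define \<J> where "\<J> = {J. I \<subseteq> J \<and> A \<notin> J \<and> (\<forall>Z\<in>J. \<forall>Y. Y \<subseteq> Z \<longrightarrow> Y \<in> J) \<and> (\<forall>Y\<in>J. \<forall>Z\<in>J. Y \<union> Z \<in> J)}"
  have "I \<in> \<J>" using assms unfolding \<J>_def by blast
  moreover have "\<Union>\<C> \<in> \<J>" if "\<C> \<noteq> {}" "subset.chain \<J> \<C>" for \<C>
  proof -
    have \<C>: "\<C> \<subseteq> \<J>" "\<And>J K. J \<in> \<C> \<Longrightarrow> K \<in> \<C> \<Longrightarrow> J \<subseteq> K \<or> K \<subseteq> J"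
      using that(2) by (auto simp: subset_chain_def)
    have "Y \<union> Z \<in> \<Union>\<C>" if YZ: "Y \<in> \<Union>\<C>" "Z \<in> \<Union>\<C>" for Y Z
    proof -
      obtain J K where JK: "J \<in> \<C>" "Y \<in> J" "K \<in> \<C>" "Z \<in> K" using YZ by blast
      then obtain L where L: "L \<in> \<C>" "Y \<in> L" "Z \<in> L" using \<C>(2)[of J K] by blast
      then have "L \<in> \<J>" using \<C>(1) by blast
      then have "Y \<union> Z \<in> L" using L unfolding \<J>_def by blast
      then show ?thesis using L(1) by blast
    qed
    moreover have "I \<subseteq> \<Union>\<C>" "A \<notin> \<Union>\<C>" "\<forall>Z\<in>\<Union>\<C>. \<forall>Y. Y \<subseteq> Z \<longrightarrow> Y \<in> \<Union>\<C>"
      using \<C>(1) that(1) unfolding \<J>_def by blast+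
    ultimately show ?thesis unfolding \<J>_def by blast
  qed
  ultimately obtain J where J: "J \<in> \<J>" "\<And>K. K \<in> \<J> \<Longrightarrow> J \<subseteq> K \<Longrightarrow> K = J"
    using subset_Zorn_nonempty[of \<J>] by blast
  have J_sub: "Y \<in> J" if "Z \<in> J" "Y \<subseteq> Z" for Y Z using J(1) that unfolding \<J>_def by blast
  have J_un: "Y \<union> Z \<in> J" if "Y \<in> J" "Z \<in> J" for Y Z using J(1) that unfolding \<J>_def by blast
  have J_I: "I \<subseteq> J" and J_A: "A \<notin> J" using J(1) unfolding \<J>_def by blast+
  have prime: "Z \<in> J \<or> A - Z \<in> J" for Z
  proof (rule ccontr)
    assume *: "\<not> (Z \<in> J \<or> A - Z \<in> J)"
    \<comment> \<open>The ideal generated by \<open>J\<close> and \<open>Z\<close>; it omits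
      \<open>A\<close> because \<open>A - Z\<close> is not in \<open>J\<close>.\<close>
    define K where "K = {Y. \<exists>X\<in>J. Y \<subseteq> X \<union> Z}"
    have "A \<notin> K"
    proof
      assume "A \<in> K"
      then obtain X where "X \<in> J" "A - Z \<subseteq> X" unfolding K_def by blast
      then show False using J_sub * by blast
    qed
    moreover have "Y \<union> Y' \<in> K" if YY': "Y \<in> K" "Y' \<in> K" for Y Y'
    proof -
      obtain X X' where "X \<in> J" "Y \<subseteq> X \<union> Z" "X' \<in> J" "Y' \<subseteq> X' \<union> Z" using YY' unfolding K_def by blast
      then have "X \<union> X' \<in> J" "Y \<union> Y' \<subseteq> (X \<union> X') \<union> Z" using J_un by blast+
      then show ?thesis unfolding K_def by blast
    qed
    moreover have JK: "J \<subseteq> K" "\<forall>X\<in>K. \<forall>Y. Y \<subseteq> X \<longrightarrow> Y \<in> K" unfolding K_def by blast+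
    ultimately have "K \<in> \<J>" using J_I unfolding \<J>_def by blast
    then have "K = J" using J(2) JK(1) by blast
    moreover have "Z \<in> K" using J_I empty unfolding K_def by blast
    ultimately show False using * by blast
  qed
  have not_both: "\<not> (Z \<in> J \<and> A - Z \<in> J)" for Z
    using J_un[of Z "A - Z"] J_sub[of "Z \<union> (A - Z)" A] J_A by blast
  have int: "Y \<inter> Z \<notin> J" if "Y \<notin> J" "Z \<notin> J" for Y Z
  proof
    assume "Y \<inter> Z \<in> J"
    moreover have "A - Y \<in> J" "A - Z \<in> J" using prime that by blast+
    ultimately have "(Y \<inter> Z) \<union> ((A - Y) \<union> (A - Z)) \<in> J" using J_un by blast
    then show False using J_sub[of _ A] J_A by blast
  qed
  have "ultrafilter_on A (\<lambda>Z. Z \<notin> J)"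
    unfolding ultrafilter_on_def
  proof (intro conjI allI impI)
    show "Z \<notin> J \<or> A - Z \<notin> J" for Z using not_both by blast
    show "\<not> {} \<notin> J" using J_I empty by blast
  qed (use J_sub int in blast)+
  then show thesis by (rule that) (use J_I in blast)
qed

section \<open>Continuity of operations on tuples\<close>

lemma continuous_map_into_power:
  assumes "\<And>x. x \<in> topspace X \<Longrightarrow> f x \<in> extensional {..<k}"
    and "\<And>j. j < k \<Longrightarrow> continuous_map X T (\<lambda>x. f x j)"
  shows "continuous_map X (power_topology T k) f"
  using assms by (simp add: continuous_map_componentwise image_subset_iff)

lemma continuous_map_power_nth:
  "i < n \<Longrightarrow> continuous_map (power_topology T n) T (\<lambda>x. x i)"
  by (rule continuous_map_product_projection[of i "{..<n}" "\<lambda>_. T"]) simp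

lemma continuous_map_seg:
  assumes "k + n \<le> N" shows "continuous_map (power_topology T N) (power_topology T n) (seg k n)"
  by (rule continuous_map_into_power)
    (use assms in \<open>auto simp: seg_def extensional_def intro!: continuous_map_power_nth\<close>)

lemma continuous_map_tuple_join_right:
  assumes "x \<in> tuples (topspace T) n"
  shows "continuous_map (power_topology T m) (power_topology T (n + m)) (tuple_join n m x)"
proof (rule continuous_map_into_power)
  fix j assume "j < n + m"
  then show "continuous_map (power_topology T m) T (\<lambda>y. tuple_join n m x y j)"
    using assms by (cases "j < n") (auto simp: tuple_join_def PiE_iff intro!: continuous_map_power_nth)
qed (simp add: tuple_join_def)

lemma continuous_map_tuple_join_left:
  assumes "y \<in> tuples (topspace T) m"
  shows "continuous_map (power_topology T n) (power_topology T (n + m)) (\<lambda>x. tuple_join n m x y)"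
proof (rule continuous_map_into_power)
  fix j assume "j < n + m"
  then show "continuous_map (power_topology T n) T (\<lambda>x. tuple_join n m x y j)"
    using assms by (cases "j < n") (auto simp: tuple_join_def PiE_iff intro!: continuous_map_power_nth)
qed (simp add: tuple_join_def)

lemma continuous_map_upd:
  assumes "a \<in> topspace T" "i < n"
  shows "continuous_map (power_topology T n) (power_topology T n) (\<lambda>x. x(i := a))"
proof (rule continuous_map_into_power)
  fix j assume "j < n"
  then show "continuous_map (power_topology T n) T (\<lambda>x. (x(i := a)) j)"
    using assms by (cases "j = i") (auto intro!: continuous_map_power_nth)
qed (use assms in \<open>auto simp: PiE_iff extensional_def\<close>)

section \<open>Types of Morley sequences\<close>

text \<open>
  A \<open>k\<close>-tuple of \<open>n\<close>-tuples is stored as a tuple of length \<open>k * n\<close>. The sets \<open>\<sigma>\<close> accepted below form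
  the type of a Morley sequence of the ultrafilter \<open>\<U>\<close>, its latest member coming first.
\<close>

primrec morley ::
  "'a set \<Rightarrow> nat \<Rightarrow> (nat \<Rightarrow> 'a) set \<Rightarrow> ((nat \<Rightarrow> 'a) set \<Rightarrow> bool) \<Rightarrow> nat \<Rightarrow> (nat \<Rightarrow> 'a) set \<Rightarrow> bool"
where
  "morley M n A \<U> 0 \<sigma> \<longleftrightarrow> (\<lambda>_. undefined) \<in> \<sigma>"
| "morley M n A \<U> (Suc k) \<sigma> \<longleftrightarrow>
     \<U> {x \<in> A. morley M n A \<U> k {a \<in> tuples M (k * n). tuple_join n (k * n) x a \<in> \<sigma>}}"

context
  fixes M :: "'a set" and n :: nat and A :: "(nat \<Rightarrow> 'a) set" and \<U> :: "(nat \<Rightarrow> 'a) set \<Rightarrow> bool"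
  assumes A: "A \<subseteq> tuples M n"
    and uf: "ultrafilter_on A \<U>"
begin

lemma morley_mono: "morley M n A \<U> k \<sigma> \<Longrightarrow> \<sigma> \<subseteq> \<tau> \<Longrightarrow> morley M n A \<U> k \<tau>"
proof (induction k arbitrary: \<sigma> \<tau>)
  case (Suc k)
  let ?fib = "\<lambda>\<sigma> x. {a \<in> tuples M (k * n). tuple_join n (k * n) x a \<in> \<sigma>}"
  have "{x \<in> A. morley M n A \<U> k (?fib \<sigma> x)} \<subseteq> {x \<in> A. morley M n A \<U> k (?fib \<tau> x)}"
  proof
    fix x assume x: "x \<in> {x \<in> A. morley M n A \<U> k (?fib \<sigma> x)}"
    have "?fib \<sigma> x \<subseteq> ?fib \<tau> x" using Suc.prems(2) by blast
    then show "x \<in> {x \<in> A. morley M n A \<U> k (?fib \<tau> x)}" using x Suc.IH by blast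
  qed
  from ultrafilter_on_mono[OF uf _ this] Suc.prems(1) show ?case by simp
qed auto

lemma morley_Int:
  "morley M n A \<U> k \<sigma> \<Longrightarrow> morley M n A \<U> k \<tau> \<Longrightarrow> morley M n A \<U> k (\<sigma> \<inter> \<tau>)"
proof (induction k arbitrary: \<sigma> \<tau>)
  case (Suc k)
  let ?fib = "\<lambda>\<sigma> x. {a \<in> tuples M (k * n). tuple_join n (k * n) x a \<in> \<sigma>}"
  have "\<U> ({x \<in> A. morley M n A \<U> k (?fib \<sigma> x)} \<inter> {x \<in> A. morley M n A \<U> k (?fib \<tau> x)})"
    using Suc.prems uf unfolding ultrafilter_on_def by simp
  moreover have "{x \<in> A. morley M n A \<U> k (?fib \<sigma> x)} \<inter> {x \<in> A. morley M n A \<U> k (?fib \<tau> x)}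
      \<subseteq> {x \<in> A. morley M n A \<U> k (?fib (\<sigma> \<inter> \<tau>) x)}"
  proof
    fix x assume x: "x \<in> {x \<in> A. morley M n A \<U> k (?fib \<sigma> x)} \<inter> {x \<in> A. morley M n A \<U> k (?fib \<tau> x)}"
    then have "morley M n A \<U> k (?fib \<sigma> x \<inter> ?fib \<tau> x)" by (intro Suc.IH) auto
    moreover have "?fib \<sigma> x \<inter> ?fib \<tau> x = ?fib (\<sigma> \<inter> \<tau>) x" by blast
    ultimately show "x \<in> {x \<in> A. morley M n A \<U> k (?fib (\<sigma> \<inter> \<tau>) x)}" using x by simp
  qed
  ultimately show ?case using ultrafilter_on_mono[OF uf] by simp
qed auto

text \<open>With \<open>morley_mono\<close>, \<open>morley_Int\<close> and
  \<open>morley_not_empty\<close> this makes \<open>morley\<close> an ultrafilter on tuples of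
  length \<open>k * n\<close>, the iterated product of \<open>\<U>\<close>.\<close>

lemma morley_compl: "morley M n A \<U> k \<sigma> \<or> morley M n A \<U> k (tuples M (k * n) - \<sigma>)"
proof (induction k arbitrary: \<sigma>)
  case (Suc k)
  let ?fib = "\<lambda>\<sigma> x. {a \<in> tuples M (k * n). tuple_join n (k * n) x a \<in> \<sigma>}"
  let ?Z = "{x \<in> A. morley M n A \<U> k (?fib \<sigma> x)}"
  have "A - ?Z \<subseteq> {x \<in> A. morley M n A \<U> k (?fib (tuples M (Suc k * n) - \<sigma>) x)}"
  proof
    fix x assume x: "x \<in> A - ?Z"
    then have "morley M n A \<U> k (tuples M (k * n) - ?fib \<sigma> x)" using Suc.IH[of "?fib \<sigma> x"] by blast
    moreover have "tuple_join n (k * n) x a \<in> tuples M (Suc k * n)" if "a \<in> tuples M (k * n)" for a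
      using tuple_join_in_tuples[OF _ that, of x n] x A by auto
    then have "tuples M (k * n) - ?fib \<sigma> x \<subseteq> ?fib (tuples M (Suc k * n) - \<sigma>) x" by blast
    ultimately have "morley M n A \<U> k (?fib (tuples M (Suc k * n) - \<sigma>) x)" by (rule morley_mono)
    then show "x \<in> {x \<in> A. morley M n A \<U> k (?fib (tuples M (Suc k * n) - \<sigma>) x)}" using x by blast
  qed
  then have "\<U> (A - ?Z) \<Longrightarrow> morley M n A \<U> (Suc k) (tuples M (Suc k * n) - \<sigma>)"
    unfolding morley.simps by (rule ultrafilter_on_mono[OF uf, rotated])
  moreover have "\<U> ?Z \<or> \<U> (A - ?Z)" using uf unfolding ultrafilter_on_def by blast
  ultimately show ?case unfolding morley.simps by blast
qed auto

lemma morley_not_empty: "\<not> morley M n A \<U> k {}"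
  by (induction k) (use uf in \<open>auto simp: ultrafilter_on_def\<close>)

lemma morley_finite_Inter:
  "finite F \<Longrightarrow> (\<And>f. f \<in> F \<Longrightarrow> morley M n A \<U> k (\<sigma> f)) \<Longrightarrow>
    morley M n A \<U> k {a \<in> tuples M (k * n). \<forall>f\<in>F. a \<in> \<sigma> f}"
proof (induction F rule: finite_induct)
  case empty
  show ?case using morley_compl[of k "{}"] morley_not_empty[of k] by simp
next
  case (insert f F)
  then have "morley M n A \<U> k (\<sigma> f \<inter> {a \<in> tuples M (k * n). \<forall>f\<in>F. a \<in> \<sigma> f})"
    by (intro morley_Int) simp_all
  then show ?case by (rule morley_mono) blast
qed

end

context definable_topological_group
begin

section \<open>Approximation from inside by compact sets\<close>

text \<open>
  \<open>L\<close> plays the role of the standard part of an instance of \<open>R\<close> over a saturated extension, and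
  \<open>honest n A A\<close> says that \<open>A\<close> has an honest definition in the sense of Chernikov and Simon.
\<close>

definition approximates ::
  "nat \<Rightarrow> (nat \<Rightarrow> 'a) set \<Rightarrow> nat \<Rightarrow> ((nat \<Rightarrow> 'a) \<Rightarrow> (nat \<Rightarrow> 'a) \<Rightarrow> bool) \<Rightarrow> (nat \<Rightarrow> 'a) set \<Rightarrow> bool" where
  "approximates n A q R F \<longleftrightarrow>
     (\<exists>L. compactin (power_topology T n) L \<and> F \<subseteq> L \<and> L \<subseteq> A \<and>
       (\<forall>W. openin (power_topology T n) W \<longrightarrow> L \<subseteq> W \<longrightarrow>
         (\<exists>b\<in>tuples (carrier G) q. \<exists>U. openin (power_topology T n) U \<and> F \<subseteq> U \<and>
            (\<forall>x\<in>U. R x b) \<and> (\<forall>x\<in>tuples (carrier G) n. R x b \<longrightarrow> x \<in> W))))"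

definition honest :: "nat \<Rightarrow> (nat \<Rightarrow> 'a) set \<Rightarrow> (nat \<Rightarrow> 'a) set \<Rightarrow> bool" where
  "honest n A Z \<longleftrightarrow> (\<exists>q R. defrel \<MM> n q R \<and>
     (\<forall>F. finite F \<longrightarrow> F \<subseteq> Z \<longrightarrow> approximates n A q R F))"

lemma honest_mono: "honest n A Z \<Longrightarrow> Y \<subseteq> Z \<Longrightarrow> honest n A Y"
  unfolding honest_def by (elim exE) (metis order_trans)

lemma honest_empty: "honest n A {}"
proof -
  have "approximates n A 0 (\<lambda>x b. False) {}"
    unfolding approximates_def by (rule exI[of _ "{}"]) auto
  moreover have "defrel \<MM> n 0 (\<lambda>x b. False)"
    unfolding defrel_def by (rule defpred_False)
  ultimately show ?thesis
    unfolding honest_def by (intro exI[of _ 0] exI[of _ "\<lambda>x b. False"]) simp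
qed

lemma approximates_Un:
  assumes "approximates n A q R F" "approximates n A q' R' F'"
  shows "approximates n A (q + q') (\<lambda>x b. R x (seg 0 q b) \<or> R' x (seg q q' b)) (F \<union> F')"
proof -
  let ?P = "power_topology T n"
  obtain L where L: "compactin ?P L" "F \<subseteq> L" "L \<subseteq> A"
    "\<And>W. openin ?P W \<Longrightarrow> L \<subseteq> W \<Longrightarrow>
      \<exists>b\<in>tuples (carrier G) q. \<exists>U. openin ?P U \<and> F \<subseteq> U \<and> (\<forall>x\<in>U. R x b) \<and>
        (\<forall>x\<in>tuples (carrier G) n. R x b \<longrightarrow> x \<in> W)"
    using assms(1) unfolding approximates_def by auto
  obtain L' where L': "compactin ?P L'" "F' \<subseteq> L'" "L' \<subseteq> A"
    "\<And>W. openin ?P W \<Longrightarrow> L' \<subseteq> W \<Longrightarrow>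
      \<exists>b\<in>tuples (carrier G) q'. \<exists>U. openin ?P U \<and> F' \<subseteq> U \<and> (\<forall>x\<in>U. R' x b) \<and>
        (\<forall>x\<in>tuples (carrier G) n. R' x b \<longrightarrow> x \<in> W)"
    using assms(2) unfolding approximates_def by auto
  show ?thesis
    unfolding approximates_def
  proof (intro exI conjI allI impI)
    show "compactin ?P (L \<union> L')" using L(1) L'(1) by (rule compactin_Un)
    show "F \<union> F' \<subseteq> L \<union> L'" "L \<union> L' \<subseteq> A" using L(2,3) L'(2,3) by blast+
    fix W assume W: "openin ?P W" "L \<union> L' \<subseteq> W"
    obtain b U where b: "b \<in> tuples (carrier G) q" "openin ?P U" "F \<subseteq> U" "\<forall>x\<in>U. R x b"
      "\<forall>x\<in>tuples (carrier G) n. R x b \<longrightarrow> x \<in> W" using L(4)[OF W(1)] W(2) by blast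
    obtain b' U' where b': "b' \<in> tuples (carrier G) q'" "openin ?P U'" "F' \<subseteq> U'" "\<forall>x\<in>U'. R' x b'"
      "\<forall>x\<in>tuples (carrier G) n. R' x b' \<longrightarrow> x \<in> W" using L'(4)[OF W(1)] W(2) by blast
    show "\<exists>b\<in>tuples (carrier G) (q + q'). \<exists>U. openin ?P U \<and> F \<union> F' \<subseteq> U \<and>
        (\<forall>x\<in>U. R x (seg 0 q b) \<or> R' x (seg q q' b)) \<and>
        (\<forall>x\<in>tuples (carrier G) n. R x (seg 0 q b) \<or> R' x (seg q q' b) \<longrightarrow> x \<in> W)"
    proof (intro bexI exI conjI)
      show "tuple_join q q' b b' \<in> tuples (carrier G) (q + q')"
        using tuple_join_in_tuples b(1) b'(1) .
      show "openin ?P (U \<union> U')" using b(2) b'(2) by (rule openin_Un)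
      show "F \<union> F' \<subseteq> U \<union> U'" using b(3) b'(3) by blast
    qed (simp_all add: seg_tuple_join_left[OF b(1)] seg_tuple_join_right[OF b'(1)],
        use b(4) b'(4) in blast, use b(5) b'(5) in simp)
  qed
qed

text \<open>With \<open>honest_mono\<close> and \<open>honest_empty\<close> this shows that the sets
  \<open>Z\<close> with \<open>honest n A Z\<close> form an ideal, to which
  \<open>ultrafilter_avoiding_ideal\<close> will be applied. Families are combined by disjunction,
  limits by union.\<close>

lemma honest_Un:
  assumes "honest n A Y" "honest n A Z" shows "honest n A (Y \<union> Z)"
proof -
  obtain q R where R: "defrel \<MM> n q R" "\<forall>F. finite F \<longrightarrow> F \<subseteq> Y \<longrightarrow> approximates n A q R F"
    using assms(1) unfolding honest_def by (elim exE conjE) (rule that)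
  obtain q' R' where R': "defrel \<MM> n q' R'" "\<forall>F. finite F \<longrightarrow> F \<subseteq> Z \<longrightarrow> approximates n A q' R' F"
    using assms(2) unfolding honest_def by (elim exE conjE) (rule that)
  let ?R = "\<lambda>x b. R x (seg 0 q b) \<or> R' x (seg q q' b)"
  have "defrel \<MM> n (q + q') ?R"
    unfolding defrel_def
    by (intro defpred_disj defrel_app[OF R(1)] defrel_app[OF R'(1)] tuple_term_seg
        tuple_term_seg_term[OF tuple_term_seg]) auto
  moreover have "approximates n A (q + q') ?R F" if F: "finite F" "F \<subseteq> Y \<union> Z" for F
  proof -
    have "approximates n A q R (F \<inter> Y)" "approximates n A q' R' (F - Y)"
      using R(2) R'(2) F by auto
    from approximates_Un[OF this] show ?thesis by (simp add: Int_Diff_Un)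
  qed
  ultimately show ?thesis
    unfolding honest_def by (intro exI[of _ "q + q'"] exI[of _ ?R]) simp
qed

section \<open>Closed fibres as honest approximations\<close>

lemma defset_fibre:
  assumes "defset \<MM> (n + m) \<sigma>" "x \<in> tuples (carrier G) n"
  shows "defset \<MM> m {a \<in> tuples (carrier G) m. tuple_join n m x a \<in> \<sigma>}"
proof -
  have "defpred \<MM> (\<lambda>e. tuple_join n m (seg 0 n e) (seg n m e) \<in> \<sigma>)"
    by (intro defset_app[OF assms(1)] tuple_term_join tuple_term_seg)
  then have "defpred \<MM> (\<lambda>e. tuple_join n m (seg 0 n e) (seg 0 m (shift n e)) \<in> \<sigma>)"
    by simp
  then have "defpred \<MM> (\<lambda>e. tuple_join n m x (seg 0 m e) \<in> \<sigma>)"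
    using defpred_const_tuple[of "\<lambda>d e. tuple_join n m d (seg 0 m e) \<in> \<sigma>" n x] assms(2) by simp
  then show ?thesis
    unfolding defset_def by (rule defpred_cong_carrier) (simp add: seg_in_tuples)
qed

lemma closedin_fibre:
  assumes "closedin (power_topology T (n + m)) \<sigma>" "x \<in> tuples (carrier G) n"
  shows "closedin (power_topology T m) {a \<in> tuples (carrier G) m. tuple_join n m x a \<in> \<sigma>}"
  using closedin_continuous_map_preimage[OF continuous_map_tuple_join_right assms(1), of x] assms(2)
  by simp

lemma closedin_fibre_left:
  assumes "closedin (power_topology T (n + m)) \<sigma>" "a \<in> tuples (carrier G) m"
  shows "closedin (power_topology T n) {x \<in> tuples (carrier G) n. tuple_join n m x a \<in> \<sigma>}"
  using closedin_continuous_map_preimage[OF continuous_map_tuple_join_left assms(1), of a] assms(2)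
  by simp

text \<open>The index \<open>p\<close> is made of blocks \<open>a\<close>, \<open>b\<close>,
  \<open>c\<close>: the fibre of \<open>\<sigma>\<close> over \<open>a\<close> is cut down to a
  power of \<open>cpt c\<close> and then thickened by \<open>bas b\<close>. Thus one definable
  family serves all fibres.\<close>

definition thick_fibre ::
  "nat \<Rightarrow> nat \<Rightarrow> (nat \<Rightarrow> 'a) set \<Rightarrow> (nat \<Rightarrow> 'a) \<Rightarrow> (nat \<Rightarrow> 'a) \<Rightarrow> bool" where
  "thick_fibre n m \<sigma> x p \<longleftrightarrow>
     seg m m\<^sub>B p \<in> nhd_indices \<and> seg (m + m\<^sub>B) m\<^sub>K p \<in> BK \<and>
     (\<exists>y\<in>tuples (carrier G) n. tuple_join n m y (seg 0 m p) \<in> \<sigma> \<and>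
        (\<forall>i<n. (seg (m + m\<^sub>B) m\<^sub>K p)(m\<^sub>K := y i) \<in> XK) \<and> near n (bas (seg m m\<^sub>B p)) y x)"

lemma defrel_thick_fibre:
  assumes "defset \<MM> (n + m) \<sigma>"
  shows "defrel \<MM> n (m + (m\<^sub>B + m\<^sub>K)) (thick_fibre n m \<sigma>)"
proof -
  have seg: "seg k l (seg n (m + (m\<^sub>B + m\<^sub>K)) e) = seg (n + k) l e" if "k + l \<le> m + (m\<^sub>B + m\<^sub>K)"
    for k l and e :: "nat \<Rightarrow> 'a"
    using that by (auto simp: seg_def fun_eq_iff add.assoc)
  show ?thesis
    unfolding defrel_def thick_fibre_def
    by (simp add: seg,
        intro defpred_conj defset_app[OF defset_nhd_indices] defset_app[OF BK(2)] tuple_term_seg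
          defpred_bex_tuples defset_app[OF assms] tuple_term_join defpred_all_less
          defset_app[OF BK(3)] tuple_term_snoc defpred_near)
      (simp_all add: tuple_term_seg var_term_nth[OF tuple_term_seg])
qed

text \<open>The limit \<open>L\<close> is the closed fibre cut with a compact box containing
  \<open>F\<close>. Keeping \<open>a\<close> and \<open>c\<close> and shrinking \<open>bas b\<close>
  brings the thickening of \<open>L\<close> into any given \<open>W\<close>, while it remains an
  open set around \<open>F\<close>.\<close>

lemma approximates_compact_fibre:
  assumes \<sigma>: "closedin (power_topology T (n + m)) \<sigma>" and a: "a \<in> tuples (carrier G) m"
    and sub: "{x \<in> tuples (carrier G) n. tuple_join n m x a \<in> \<sigma>} \<subseteq> A"
    and F: "finite F" "F \<subseteq> {x \<in> tuples (carrier G) n. tuple_join n m x a \<in> \<sigma>}"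
  shows "approximates n A (m + (m\<^sub>B + m\<^sub>K)) (thick_fibre n m \<sigma>) F"
proof -
  let ?P = "power_topology T n"
  \<comment> \<open>The finite set of coordinates of points of \<open>F\<close> is compact, so
    cofinality of the compact family provides \<open>c\<close>.\<close>
  let ?E = "\<Union>f\<in>F. f ` {..<n}"
  have "finite ?E" "?E \<subseteq> carrier G" using F by (auto simp: PiE_iff)
  then have "compactin T ?E" by (intro finite_imp_compactin) auto
  then obtain c where c: "c \<in> BK" "?E \<subseteq> cpt c" using cofinal_BK unfolding cpt_def by blast
  define L where "L = {x \<in> tuples (carrier G) n. tuple_join n m x a \<in> \<sigma>} \<inter> PiE {..<n} (\<lambda>_. cpt c)"
  have "compactin ?P (PiE {..<n} (\<lambda>_. cpt c))"
    using compact_BK[OF c(1)] by (simp add: compactin_PiE cpt_def)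
  then have L_compact: "compactin ?P L"
    unfolding L_def by (rule closed_Int_compactin[OF closedin_fibre_left[OF \<sigma> a]])
  have L_sub: "L \<subseteq> tuples (carrier G) n" unfolding L_def by blast
  have FL: "F \<subseteq> L"
  proof
    fix f assume f: "f \<in> F"
    have "f i \<in> cpt c" if "i < n" for i using c(2) f that by blast
    moreover have "f \<in> extensional {..<n}" using f F(2) by (auto simp: PiE_iff)
    ultimately show "f \<in> L" using f F(2) unfolding L_def by (auto simp: PiE_iff)
  qed
  have LA: "L \<subseteq> A" using sub unfolding L_def by blast
  show ?thesis
    unfolding approximates_def
  proof (rule exI[of _ L], intro conjI allI impI L_compact FL LA)
    fix W assume W: "openin ?P W" "L \<subseteq> W"
    obtain V where V: "nhd V" "thicken n V L \<subseteq> W"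
      using compact_thicken_subset[OF L_compact W] by blast
    obtain b where b: "b \<in> nhd_indices" "bas b \<subseteq> V" using nhd_contains_bas[OF V(1)] .
    let ?bc = "tuple_join m\<^sub>B m\<^sub>K b c"
    let ?p = "tuple_join m (m\<^sub>B + m\<^sub>K) a ?bc"
    have bt: "b \<in> tuples (carrier G) m\<^sub>B" and ct: "c \<in> tuples (carrier G) m\<^sub>K"
      using b(1) c(1) nhd_indices_subset BK(1) by blast+
    then have p: "?p \<in> tuples (carrier G) (m + (m\<^sub>B + m\<^sub>K))"
      using a by (intro tuple_join_in_tuples)
    have seg: "seg 0 m ?p = a" "seg m m\<^sub>B ?p = b" "seg (m + m\<^sub>B) m\<^sub>K ?p = c"
      using seg_tuple_join_left[OF a] seg_tuple_join_add[of 0 m\<^sub>B "m\<^sub>B + m\<^sub>K" m a ?bc]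
        seg_tuple_join_add[of m\<^sub>B m\<^sub>K "m\<^sub>B + m\<^sub>K" m a ?bc] seg_tuple_join_left[OF bt]
        seg_tuple_join_right[OF ct] by simp_all
    have fibre: "thick_fibre n m \<sigma> x ?p \<longleftrightarrow> x \<in> thicken n (bas b) L" if x: "x \<in> tuples (carrier G) n" for x
    proof -
      have "y \<in> L \<longleftrightarrow> tuple_join n m y a \<in> \<sigma> \<and> (\<forall>i<n. c(m\<^sub>K := y i) \<in> XK)"
        if "y \<in> tuples (carrier G) n" for y
        using that unfolding L_def cpt_def by (auto simp: PiE_iff)
      then show ?thesis
        using x b(1) c(1) L_sub unfolding thick_fibre_def seg thicken_def by blast
    qed
    show "\<exists>p\<in>tuples (carrier G) (m + (m\<^sub>B + m\<^sub>K)). \<exists>U. openin ?P U \<and> F \<subseteq> U \<and>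
        (\<forall>x\<in>U. thick_fibre n m \<sigma> x p) \<and>
        (\<forall>x\<in>tuples (carrier G) n. thick_fibre n m \<sigma> x p \<longrightarrow> x \<in> W)"
    proof (rule bexI[OF _ p], rule exI[of _ "thicken n (bas b) L"], intro conjI ballI impI)
      show "openin ?P (thicken n (bas b) L)" using openin_thicken[OF L_sub nhd_bas[OF b(1)]] .
      show "F \<subseteq> thicken n (bas b) L" using FL subset_thicken[OF L_sub nhd_bas[OF b(1)]] by (rule order_trans)
      show "thick_fibre n m \<sigma> x ?p" if "x \<in> thicken n (bas b) L" for x
        using that fibre[of x] unfolding thicken_def by blast
      show "x \<in> W" if "x \<in> tuples (carrier G) n" "thick_fibre n m \<sigma> x ?p" for x
        using that fibre[of x] thicken_mono[OF b(2)] V(2) by blast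
    qed
  qed
qed

end

context definable_topological_group
begin

text \<open>
  If \<open>\<sigma>\<close> belongs to the type of a Morley sequence, membership of the entries in \<open>A\<close> can be
  prescribed freely: an entry outside \<open>A\<close> exists because otherwise a closed fibre of \<open>\<sigma>\<close> would be
  an honest approximation of \<open>A\<close> from inside.
\<close>

lemma morley_prescribe:
  assumes A: "A \<subseteq> tuples (carrier G) n"
    and uf: "ultrafilter_on A \<U>"
    and not_honest: "\<And>Z. \<U> Z \<Longrightarrow> \<not> honest n A Z"
  shows "closedin (power_topology T (k * n)) \<sigma> \<Longrightarrow> defset \<MM> (k * n) \<sigma> \<Longrightarrow>
    morley (carrier G) n A \<U> k \<sigma> \<Longrightarrow> \<exists>a\<in>\<sigma>. \<forall>i<k. seg (i * n) n a \<in> A \<longleftrightarrow> i \<in> S"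
proof (induction k arbitrary: \<sigma> S)
  case 0
  then show ?case by auto
next
  case (Suc k)
  let ?m = "k * n"
  let ?fib = "\<lambda>x. {a \<in> tuples (carrier G) ?m. tuple_join n ?m x a \<in> \<sigma>}"
  \<comment> \<open>Entry 0 is the head \<open>x\<close>; the pattern for the tail is moved down by
    one.\<close>
  let ?S = "{i. Suc i \<in> S}"
  have \<sigma>: "closedin (power_topology T (n + ?m)) \<sigma>" "defset \<MM> (n + ?m) \<sigma>"
    using Suc.prems(1,2) by simp_all
  define Z where "Z = {x \<in> A. morley (carrier G) n A \<U> k (?fib x)}"
  have Z: "\<U> Z" using Suc.prems(3) by (simp add: Z_def)
  have Z_tuples: "x \<in> tuples (carrier G) n" if "x \<in> Z" for x using that A unfolding Z_def by blast
  have extend: "\<exists>a\<in>\<sigma>. \<forall>i<Suc k. seg (i * n) n a \<in> A \<longleftrightarrow> i \<in> S"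
    if x: "x \<in> tuples (carrier G) n" "x \<in> A \<longleftrightarrow> 0 \<in> S"
      and a: "tuple_join n ?m x a \<in> \<sigma>" "\<forall>i<k. seg (i * n) n a \<in> A \<longleftrightarrow> i \<in> ?S" for x a
  proof (rule bexI[OF _ a(1)], intro allI impI)
    fix i assume i: "i < Suc k"
    show "seg (i * n) n (tuple_join n ?m x a) \<in> A \<longleftrightarrow> i \<in> S"
    proof (cases i)
      case 0
      then show ?thesis using x seg_tuple_join_left[OF x(1)] by simp
    next
      case (Suc j)
      then have "j < k" using i by simp
      then have "Suc j * n \<le> k * n" by (intro mult_le_mono1) simp
      then have "j * n + n \<le> ?m" by simp
      from seg_tuple_join_add[OF this, of n x a] have "seg (i * n) n (tuple_join n ?m x a) = seg (j * n) n a"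
        using Suc by simp
      then show ?thesis using a(2) \<open>j < k\<close> Suc by simp
    qed
  qed
  show ?case
  proof (cases "0 \<in> S")
    case True
    obtain x where x: "x \<in> Z" using Z uf unfolding ultrafilter_on_def by (cases "Z = {}") auto
    then have "morley (carrier G) n A \<U> k (?fib x)" by (simp add: Z_def)
    from Suc.IH[OF closedin_fibre[OF \<sigma>(1) Z_tuples[OF x]] defset_fibre[OF \<sigma>(2) Z_tuples[OF x]] this, of ?S]
    obtain a where "a \<in> ?fib x" "\<forall>i<k. seg (i * n) n a \<in> A \<longleftrightarrow> i \<in> ?S" by blast
    moreover have "x \<in> A \<longleftrightarrow> 0 \<in> S" using x True by (simp add: Z_def)
    ultimately show ?thesis using extend[OF Z_tuples[OF x], of a] by simp
  next
    case False
    \<comment> \<open>\<open>Z\<close> is large, so the family \<open>thick_fibre\<close> cannot be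
      an honest definition on it and fails for some finite \<open>F\<close>.\<close>
    have "\<not> honest n A Z" using not_honest Z .
    then obtain F where F: "finite F" "F \<subseteq> Z"
      "\<not> approximates n A (?m + (m\<^sub>B + m\<^sub>K)) (thick_fibre n ?m \<sigma>) F"
      using defrel_thick_fibre[OF \<sigma>(2)] unfolding honest_def by blast
    \<comment> \<open>The tails whose fibre contains all of \<open>F\<close>. This set stays in the
      type because \<open>F\<close> is finite, and the induction hypothesis picks from it a tail
      with the prescribed pattern.\<close>
    define \<tau> where "\<tau> = {a \<in> tuples (carrier G) ?m. \<forall>f\<in>F. a \<in> ?fib f}"
    have "morley (carrier G) n A \<U> k \<tau>"
      unfolding \<tau>_def using F
      by (intro morley_finite_Inter[OF A uf]) (auto simp: Z_def)
    moreover have "closedin (power_topology T ?m) \<tau>"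
    proof -
      have eq: "\<tau> = \<Inter> (insert (tuples (carrier G) ?m) (?fib ` F))" unfolding \<tau>_def by auto
      have "closedin (power_topology T ?m) (tuples (carrier G) ?m)"
        using closedin_topspace[of "power_topology T ?m"] by simp
      then show ?thesis
        unfolding eq using closedin_fibre[OF \<sigma>(1) Z_tuples] F(2) by (intro closedin_Inter) auto
    qed
    moreover have "defset \<MM> ?m \<tau>"
    proof -
      have "defpred \<MM> (\<lambda>e. \<forall>f\<in>F. seg 0 ?m e \<in> ?fib f)"
        using defset_fibre[OF \<sigma>(2) Z_tuples] F(2)
        by (intro defpred_finite_ball[OF F(1)]) (auto simp: defset_def)
      then show ?thesis
        unfolding defset_def by (rule defpred_cong_carrier) (simp add: \<tau>_def seg_in_tuples)
    qed
    ultimately obtain a where a: "a \<in> \<tau>" "\<forall>i<k. seg (i * n) n a \<in> A \<longleftrightarrow> i \<in> ?S"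
      using Suc.IH[of \<tau> ?S] by blast
    have at: "a \<in> tuples (carrier G) ?m" using a(1) by (simp add: \<tau>_def)
    have "F \<subseteq> {x \<in> tuples (carrier G) n. tuple_join n ?m x a \<in> \<sigma>}"
      using a(1) F(2) Z_tuples unfolding \<tau>_def by blast
    \<comment> \<open>Were this fibre contained in \<open>A\<close>,
      \<open>approximates_compact_fibre\<close> would contradict the choice of \<open>F\<close>; so
      a head outside \<open>A\<close> exists.\<close>
    then have "\<not> {x \<in> tuples (carrier G) n. tuple_join n ?m x a \<in> \<sigma>} \<subseteq> A"
      using approximates_compact_fibre[OF \<sigma>(1) at _ F(1)] F(3) by blast
    then obtain x where "x \<in> tuples (carrier G) n" "tuple_join n ?m x a \<in> \<sigma>" "x \<notin> A" by blast
    then show ?thesis using extend[of x a] a(2) False by simp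
  qed
qed

text \<open>If the ideal of honest sets omits \<open>A\<close>, an ultrafilter avoiding it puts
  every pattern set \<open>\<sigma> S\<close> into the Morley type. The finitely many
  \<open>\<sigma> S\<close> with \<open>S \<subseteq> {..<k}\<close> then have a common element,
  whose \<open>k\<close> entries are shattered by \<open>R\<close>, against NIP.\<close>

lemma ext_def_imp_honest:
  assumes "ext_def n A" shows "honest n A A"
proof (rule ccontr)
  assume "\<not> honest n A A"
  then obtain \<U> where \<U>: "ultrafilter_on A \<U>" "\<And>Z. \<U> Z \<Longrightarrow> \<not> honest n A Z"
    using ultrafilter_avoiding_ideal[of "{Z. honest n A Z}" A]
    by (auto intro: honest_mono honest_Un honest_empty)
  obtain q R where A: "A \<subseteq> tuples (carrier G) n" "defrel \<MM> n q R"
    "\<And>F F'. finite F \<Longrightarrow> finite F' \<Longrightarrow> F \<subseteq> A \<Longrightarrow> F' \<subseteq> tuples (carrier G) n - A \<Longrightarrow>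
       \<exists>b\<in>tuples (carrier G) q. separates n (\<lambda>x. R x b) F F'"
    by (rule ext_defE[OF assms]) (rule that)
  obtain k where k: "\<And>B. B \<subseteq> tuples (carrier G) n \<Longrightarrow> finite B \<Longrightarrow> card B = k \<Longrightarrow>
      \<forall>S\<subseteq>B. \<exists>b\<in>tuples (carrier G) q. \<forall>x\<in>B. R x b \<longleftrightarrow> x \<in> S \<Longrightarrow> False"
    by (rule NIP_bound[OF A(2)]) (rule that)
  let ?P = "power_topology T (k * n)"
  have block: "i * n + n \<le> k * n" if "i < k" for i
    using mult_le_mono1[of "Suc i" k n] that by simp
  have block_in: "seg (i * n) n a \<in> tuples (carrier G) n" if "i < k" "a \<in> tuples (carrier G) (k * n)" for i a
    using seg_tuple_in_tuples[OF that(2) block[OF that(1)]] .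
  define \<sigma> where "\<sigma> S = {a \<in> tuples (carrier G) (k * n).
      \<exists>b\<in>tuples (carrier G) q. \<forall>i<k. R (seg (i * n) n a) b \<longleftrightarrow> i \<in> S}" for S
  have morley_\<sigma>: "morley (carrier G) n A \<U> k (\<sigma> S)" for S
  proof (rule ccontr)
    assume "\<not> morley (carrier G) n A \<U> k (\<sigma> S)"
    let ?C = "tuples (carrier G) (k * n) - \<sigma> S"
    have "morley (carrier G) n A \<U> k ?C"
      using morley_compl[OF A(1) \<U>(1), of k "\<sigma> S"] \<open>\<not> morley _ _ _ _ _ (\<sigma> S)\<close> by blast
    \<comment> \<open>The complement of \<open>\<sigma> S\<close> need not be closed, whereas
      \<open>morley_prescribe\<close> asks for a closed set; so it is enlarged to its closure, which
      is still definable.\<close>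
    then have "morley (carrier G) n A \<U> k (?P closure_of ?C)"
      by (rule morley_mono[OF A(1) \<U>(1)]) (rule closure_of_subset, simp)
    moreover have "defset \<MM> (k * n) (?P closure_of ?C)"
    proof (rule defset_closure)
      have "defpred \<MM> (\<lambda>e. \<not> (\<exists>b\<in>tuples (carrier G) q. \<forall>i<k. R (seg (i * n) n e) b \<longleftrightarrow> i \<in> S))"
        by (intro defpred_not defpred_bex_tuples defpred_all_less defpred_iff_const defrel_app[OF A(2)])
          (simp_all add: tuple_term_seg)
      then show "defset \<MM> (k * n) ?C"
        unfolding defset_def
      proof (rule defpred_cong_carrier)
        fix e :: "nat \<Rightarrow> 'a" assume "\<And>i. e i \<in> carrier G"
        then have "seg 0 (k * n) e \<in> tuples (carrier G) (k * n)" by (intro seg_in_tuples)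
        moreover have "seg (i * n) n (seg 0 (k * n) e) = seg (i * n) n e" if "i < k" for i
          using block[OF that] by (auto simp: seg_def fun_eq_iff)
        ultimately show "(\<not> (\<exists>b\<in>tuples (carrier G) q. \<forall>i<k. R (seg (i * n) n e) b \<longleftrightarrow> i \<in> S))
            = (seg 0 (k * n) e \<in> ?C)"
          by (simp add: \<sigma>_def)
      qed
    qed blast
    ultimately obtain a where a: "a \<in> ?P closure_of ?C" "\<forall>i<k. seg (i * n) n a \<in> A \<longleftrightarrow> i \<in> S"
      using morley_prescribe[OF A(1) \<U>, of k "?P closure_of ?C" S] by auto
    have at: "a \<in> tuples (carrier G) (k * n)"
      using a(1) closure_of_subset_topspace[of ?P ?C] by auto
    let ?F = "\<lambda>I. (\<lambda>i. seg (i * n) n a) ` I"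
    \<comment> \<open>The entries of \<open>a\<close> lie in \<open>A\<close> exactly for the
      indices in \<open>S\<close>, so the family separates them according to that pattern.\<close>
    obtain b where b: "b \<in> tuples (carrier G) q"
      "separates n (\<lambda>x. R x b) (?F ({..<k} \<inter> S)) (?F ({..<k} - S))"
      using A(3)[of "?F ({..<k} \<inter> S)" "?F ({..<k} - S)"] a(2) block_in[OF _ at] by auto
    obtain U U' where U: "openin (power_topology T n) U" "openin (power_topology T n) U'"
      "?F ({..<k} \<inter> S) \<subseteq> U" "?F ({..<k} - S) \<subseteq> U'" "\<forall>x\<in>U. R x b" "\<forall>x\<in>U'. \<not> R x b"
      using b(2) unfolding separates_def by blast
    define V where "V i = (if i \<in> S then U else U')" for i
    \<comment> \<open>An open neighbourhood of \<open>a\<close> on which \<open>b\<close> produces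
      the pattern \<open>S\<close>. It meets \<open>?C\<close> since \<open>a\<close> is in the
      closure, although all its points belong to \<open>\<sigma> S\<close>.\<close>
    define N where "N = {x \<in> tuples (carrier G) (k * n). \<forall>i<k. seg (i * n) n x \<in> V i}"
    have "N = \<Inter> (insert (topspace ?P)
        ((\<lambda>i. {x \<in> topspace ?P. seg (i * n) n x \<in> V i}) ` {..<k}))"
      unfolding N_def by auto
    moreover have "openin ?P {x \<in> topspace ?P. seg (i * n) n x \<in> V i}" if "i < k" for i
      using U(1,2) by (intro openin_continuous_map_preimage[OF continuous_map_seg[OF block[OF that]]]) (simp add: V_def)
    then have "openin ?P (\<Inter> (insert (topspace ?P)
        ((\<lambda>i. {x \<in> topspace ?P. seg (i * n) n x \<in> V i}) ` {..<k})))"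
      by (intro openin_Inter) (auto simp del: topspace_product_topology)
    ultimately have "openin ?P N" by simp
    moreover have "a \<in> N"
      using at U(3,4) unfolding N_def V_def by (auto simp: image_subset_iff)
    ultimately obtain z where z: "z \<in> ?C" "z \<in> N" using a(1) unfolding in_closure_of by blast
    have "R (seg (i * n) n z) b \<longleftrightarrow> i \<in> S" if "i < k" for i
      using z(2) that U(5,6) unfolding N_def V_def by (cases "i \<in> S") auto
    then have "z \<in> \<sigma> S" using z(1) b(1) unfolding \<sigma>_def by blast
    then show False using z(1) by blast
  qed
  have "morley (carrier G) n A \<U> k {a \<in> tuples (carrier G) (k * n). \<forall>S\<in>Pow {..<k}. a \<in> \<sigma> S}"
    using morley_\<sigma> by (intro morley_finite_Inter[OF A(1) \<U>(1)]) simp_all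
  then have "{a \<in> tuples (carrier G) (k * n). \<forall>S\<in>Pow {..<k}. a \<in> \<sigma> S} \<noteq> {}"
    using morley_not_empty[OF A(1) \<U>(1), of k] by metis
  then obtain a where a: "a \<in> tuples (carrier G) (k * n)" "\<And>S. S \<subseteq> {..<k} \<Longrightarrow> a \<in> \<sigma> S"
    by blast
  let ?x = "\<lambda>i. seg (i * n) n a"
  have shatter: "\<exists>b\<in>tuples (carrier G) q. \<forall>i<k. R (?x i) b \<longleftrightarrow> i \<in> S" if "S \<subseteq> {..<k}" for S
    using a(2)[OF that] by (simp add: \<sigma>_def)
  have "inj_on ?x {..<k}"
  proof (rule inj_onI)
    fix i j assume ij: "i \<in> {..<k}" "j \<in> {..<k}" "?x i = ?x j"
    then obtain b where "\<forall>l<k. R (?x l) b \<longleftrightarrow> l \<in> {i}" using shatter[of "{i}"] by auto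
    then show "i = j" using ij by (metis lessThan_iff singletonD singletonI)
  qed
  then have "card (?x ` {..<k}) = k" by (simp add: card_image)
  moreover have "?x ` {..<k} \<subseteq> tuples (carrier G) n" using block_in[OF _ a(1)] by auto
  moreover have "\<exists>b\<in>tuples (carrier G) q. \<forall>x\<in>?x ` {..<k}. R x b \<longleftrightarrow> x \<in> S" for S
    using shatter[of "{i \<in> {..<k}. ?x i \<in> S}"] by auto
  ultimately show False using k[of "?x ` {..<k}"] by simp
qed

section \<open>Projections of externally definable sets\<close>

text \<open>Coordinate \<open>i\<close> is quantified but kept, so the length of tuples does not
  change. Witnesses lift \<open>F\<close> into \<open>A\<close>, an honest definition encloses the
  lift in a compact \<open>L \<subseteq> A\<close>, and the projection of \<open>L\<close> is
  compact and disjoint from that of \<open>F'\<close>.\<close>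

lemma ext_def_project:
  assumes "ext_def n A" "i < n"
  shows "ext_def n {x \<in> tuples (carrier G) n. \<exists>a\<in>carrier G. x(i := a) \<in> A}" (is "ext_def n ?A'")
proof -
  let ?P = "power_topology T n"
  have A: "A \<subseteq> tuples (carrier G) n" using assms(1) by (simp add: ext_def_def)
  obtain q R where R: "defrel \<MM> n q R" "\<And>F. finite F \<Longrightarrow> F \<subseteq> A \<Longrightarrow> approximates n A q R F"
    using ext_def_imp_honest[OF assms(1)] unfolding honest_def by blast
  have cont: "continuous_map ?P ?P (\<lambda>x. x(i := a))" if "a \<in> carrier G" for a
    using continuous_map_upd[of a T i n] that assms(2) by simp
  have upd: "x(i := a) \<in> tuples (carrier G) n" if "x \<in> tuples (carrier G) n" "a \<in> carrier G" for x a
    using that assms(2) by (auto simp: PiE_iff extensional_def)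
  show ?thesis
  proof (rule ext_defI)
    show "?A' \<subseteq> tuples (carrier G) n" by blast
    show "defrel \<MM> n q (\<lambda>x b. \<exists>a\<in>carrier G. R (x(i := a)) b)"
      unfolding defrel_def
      by (intro defpred_bex_carrier defrel_app[OF R(1)] tuple_term_upd assms(2) var_term_env)
        (simp_all add: tuple_term_seg)
    fix F F' assume F: "finite F" "finite F'" "F \<subseteq> ?A'" "F' \<subseteq> tuples (carrier G) n - ?A'"
    have "\<forall>f\<in>F. \<exists>a. a \<in> carrier G \<and> f(i := a) \<in> A" using F(3) by auto
    from bchoice[OF this] obtain w where w: "\<And>f. f \<in> F \<Longrightarrow> w f \<in> carrier G \<and> f(i := w f) \<in> A"
      by auto
    let ?F = "(\<lambda>f. f(i := w f)) ` F"
    have "finite ?F" "?F \<subseteq> A" using F(1) w by auto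
    then have "approximates n A q R ?F" by (rule R(2))
    then obtain L where L: "compactin ?P L" "?F \<subseteq> L" "L \<subseteq> A"
      "\<forall>W. openin ?P W \<longrightarrow> L \<subseteq> W \<longrightarrow>
        (\<exists>b\<in>tuples (carrier G) q. \<exists>U. openin ?P U \<and> ?F \<subseteq> U \<and> (\<forall>x\<in>U. R x b) \<and>
          (\<forall>x\<in>tuples (carrier G) n. R x b \<longrightarrow> x \<in> W))"
      unfolding approximates_def by (elim exE conjE) (rule that)
    \<comment> \<open>resetting the \<open>i\<close>-th coordinate to \<open>\<one>\<close> plays the role of the projection\<close>
    let ?r = "\<lambda>x. x(i := \<one>)"
    have "Hausdorff_space ?P" using hausdorff by (simp add: Hausdorff_space_product_topology)
    moreover have "compactin ?P (?r ` L)"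
      using image_compactin[OF L(1) cont[OF one_closed]] .
    moreover have "compactin ?P (?r ` F')"
      using F(2,4) upd by (intro finite_imp_compactin) auto
    moreover have "disjnt (?r ` L) (?r ` F')"
    proof -
      \<comment> \<open>If the two projections agreed, replacing coordinate \<open>i\<close> of
        \<open>f\<close> by \<open>l i\<close> would give \<open>l\<close>, so \<open>f\<close>
        would have a witness.\<close>
      have False if l: "l \<in> L" "f \<in> F'" "?r l = ?r f" for l f
      proof -
        have "f(i := l i) = (?r f)(i := l i)" by simp
        also have "\<dots> = l" unfolding l(3)[symmetric] by simp
        finally have "f(i := l i) = l" .
        moreover have "l \<in> A" "l i \<in> carrier G"
          using l(1) L(3) A PiE_mem[of l "{..<n}" "\<lambda>_. carrier G" i] assms(2) by auto
        ultimately have "\<exists>a\<in>carrier G. f(i := a) \<in> A" by (intro bexI[of _ "l i"]) simp_all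
        then have "f \<in> ?A'" using F(4) l(2) by blast
        then show False using F(4) l(2) by blast
      qed
      then show ?thesis unfolding disjnt_iff by blast
    qed
    ultimately obtain W U' where WU': "openin ?P W" "openin ?P U'" "?r ` L \<subseteq> W" "?r ` F' \<subseteq> U'" "disjnt W U'"
      by (rule Hausdorff_space_compact_separation)
    \<comment> \<open>Pulling \<open>W\<close> back gives an open set around \<open>L\<close>; the
      honest definition then yields a member all of whose points project into \<open>W\<close>,
      hence away from \<open>U'\<close>.\<close>
    have "openin ?P {x \<in> topspace ?P. ?r x \<in> W}" "L \<subseteq> {x \<in> topspace ?P. ?r x \<in> W}"
      using openin_continuous_map_preimage[OF cont[OF one_closed] WU'(1)] WU'(3) L(3) A by auto
    from L(4)[rule_format, OF this] obtain b U where b: "b \<in> tuples (carrier G) q" "openin ?P U" "?F \<subseteq> U"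
      "\<forall>x\<in>U. R x b" "\<forall>x\<in>tuples (carrier G) n. R x b \<longrightarrow> ?r x \<in> W"
      by blast
    have "separates n (\<lambda>x. \<exists>a\<in>carrier G. R (x(i := a)) b) F F'"
      unfolding separates_def
    proof (intro exI conjI)
      show "openin ?P (\<Union>a\<in>carrier G. {x \<in> topspace ?P. x(i := a) \<in> U})"
        using openin_continuous_map_preimage[OF cont b(2)] by (intro openin_Union) blast
      show "openin ?P {x \<in> topspace ?P. ?r x \<in> U'}"
        using openin_continuous_map_preimage[OF cont[OF one_closed] WU'(2)] .
      show "F \<subseteq> (\<Union>a\<in>carrier G. {x \<in> topspace ?P. x(i := a) \<in> U})"
      proof
        fix f assume f: "f \<in> F"
        then have "f \<in> tuples (carrier G) n" using F(3) by blast
        moreover have "f(i := w f) \<in> U" using f by (intro subsetD[OF b(3)] imageI)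
        ultimately show "f \<in> (\<Union>a\<in>carrier G. {x \<in> topspace ?P. x(i := a) \<in> U})"
          using w[OF f] by (intro UN_I[of "w f"]) simp_all
      qed
      show "F' \<subseteq> {x \<in> topspace ?P. ?r x \<in> U'}" using F(4) WU'(4) by auto
      show "\<forall>x\<in>\<Union>a\<in>carrier G. {x \<in> topspace ?P. x(i := a) \<in> U}. \<exists>a\<in>carrier G. R (x(i := a)) b"
        using b(4) by blast
      show "\<forall>x\<in>{x \<in> topspace ?P. ?r x \<in> U'}. \<not> (\<exists>a\<in>carrier G. R (x(i := a)) b)"
      proof (intro ballI notI)
        fix x assume x: "x \<in> {x \<in> topspace ?P. ?r x \<in> U'}" and "\<exists>a\<in>carrier G. R (x(i := a)) b"
        then obtain a where a: "a \<in> carrier G" "R (x(i := a)) b" by blast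
        have "x(i := a) \<in> tuples (carrier G) n" using upd[of x a] x a(1) by simp
        from b(5)[rule_format, OF this a(2)] have "?r x \<in> W" by simp
        then show False using x WU'(5) unfolding disjnt_iff by blast
      qed
    qed
    then show "\<exists>b\<in>tuples (carrier G) q. separates n (\<lambda>x. \<exists>a\<in>carrier G. R (x(i := a)) b) F F'"
      using b(1) by blast
  qed
qed

section \<open>The open core\<close>

lemma open_core_simps [simp]:
  "universe (open_core T \<MM>) = carrier G" "funs (open_core T \<MM>) = {}"
  "rel_arity (open_core T \<MM>) = fst" "rel_interp (open_core T \<MM>) = snd"
  by (simp_all add: open_core_def)

lemma wf_tm_open_core:
  assumes "wf_tm (open_core T \<MM>) t" obtains i where "t = Var i"
  using assms by (cases t) auto

lemma ext_def_eq:
  assumes "i < n" "j < n" shows "ext_def n {x \<in> tuples (carrier G) n. x i = x j}"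
proof (rule ext_def_closed)
  show "closedin (power_topology T n) {x \<in> tuples (carrier G) n. x i = x j}"
    using closedin_continuous_maps_eq[OF hausdorff continuous_map_power_nth[OF assms(1)]
        continuous_map_power_nth[OF assms(2)]] by simp
  have "defpred \<MM> (\<lambda>e. e i = e j)" by (intro defpred_eq var_term_env)
  then show "defset \<MM> n {x \<in> tuples (carrier G) n. x i = x j}"
    unfolding defset_def
  proof (rule defpred_cong_carrier)
    fix e :: "nat \<Rightarrow> 'a" assume "\<And>i. e i \<in> carrier G"
    then have "seg 0 n e \<in> tuples (carrier G) n" by (intro seg_in_tuples)
    then show "(e i = e j) = (seg 0 n e \<in> {x \<in> tuples (carrier G) n. x i = x j})"
      using assms by (simp add: seg_def)
  qed
qed

lemma ext_def_reindexed_closed: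
  assumes "closedin (power_topology T k) C" "defset \<MM> k C" "\<And>j. j < k \<Longrightarrow> g j < n"
  shows "ext_def n {x \<in> tuples (carrier G) n. (\<lambda>j\<in>{..<k}. x (g j)) \<in> C}"
proof (rule ext_def_closed)
  have "continuous_map (power_topology T n) (power_topology T k) (\<lambda>x. \<lambda>j\<in>{..<k}. x (g j))"
    by (rule continuous_map_into_power) (use assms(3) continuous_map_power_nth in auto)
  from closedin_continuous_map_preimage[OF this assms(1)]
  show "closedin (power_topology T n) {x \<in> tuples (carrier G) n. (\<lambda>j\<in>{..<k}. x (g j)) \<in> C}"
    by simp
  have "defpred \<MM> (\<lambda>e. (\<lambda>j\<in>{..<k}. e (g j)) \<in> C)"
    by (intro defset_app[OF assms(2)] tuple_term_restrict var_term_env)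
  then show "defset \<MM> n {x \<in> tuples (carrier G) n. (\<lambda>j\<in>{..<k}. x (g j)) \<in> C}"
    unfolding defset_def
  proof (rule defpred_cong_carrier)
    fix e :: "nat \<Rightarrow> 'a" assume "\<And>i. e i \<in> carrier G"
    then have "seg 0 n e \<in> tuples (carrier G) n" by (intro seg_in_tuples)
    moreover have "(\<lambda>j\<in>{..<k}. seg 0 n e (g j)) = (\<lambda>j\<in>{..<k}. e (g j))"
      using assms(3) by (auto simp: seg_def restrict_def)
    ultimately show "((\<lambda>j\<in>{..<k}. e (g j)) \<in> C)
        = (seg 0 n e \<in> {x \<in> tuples (carrier G) n. (\<lambda>j\<in>{..<k}. x (g j)) \<in> C})"
      by simp
  qed
qed

text \<open>The threshold \<open>N\<^sub>0\<close> leaves room for all variables of the formula,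
  bound ones included, so that updating a coordinate stays among the \<open>N\<close>-tuples. Asking
  for all larger \<open>N\<close> lets both parts of a conjunction be treated at one length.\<close>

lemma open_core_ext_def:
  "wf_fm (open_core T \<MM>) \<phi> \<Longrightarrow>
    \<exists>N\<^sub>0. \<forall>N\<ge>N\<^sub>0. ext_def N {x \<in> tuples (carrier G) N. sat (open_core T \<MM>) x \<phi>}"
proof (induction \<phi>)
  case (Equal s t)
  then obtain i j where ij: "s = Var i" "t = Var j"
    using wf_tm_open_core by (metis wf_fm.simps(1))
  show ?case
    unfolding ij using ext_def_eq by (intro exI[of _ "Suc (max i j)"]) simp
next
  case (Atom r ts)
  then obtain k X where r: "r = (k, power_topology T k closure_of X)" "definable \<MM> k X"
    by (auto simp: open_core_def)
  have len: "length ts = k" and ts: "\<forall>t\<in>set ts. wf_tm (open_core T \<MM>) t"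
    using Atom r(1) by (simp_all add: list_all_iff)
  define g where "g j = (SOME i. ts ! j = Var i)" for j
  have g: "ts ! j = Var (g j)" if "j < k" for j
  proof -
    have "wf_tm (open_core T \<MM>) (ts ! j)" using ts len that by simp
    then obtain i where "ts ! j = Var i" by (rule wf_tm_open_core)
    then show ?thesis unfolding g_def by (rule someI)
  qed
  have tuple: "tuple_of_list (map (eval_tm (open_core T \<MM>) x) ts) = (\<lambda>j\<in>{..<k}. x (g j))" for x
    using g by (auto simp: tuple_of_list_def len fun_eq_iff)
  have X: "X \<subseteq> tuples (carrier G) k" using definable_subset[OF r(2)] by simp
  have "ext_def N {x \<in> tuples (carrier G) N. sat (open_core T \<MM>) x (Atom r ts)}"
    \<comment> \<open>Inserting 0 keeps \<open>Max\<close> meaningful for relations of arity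
      0.\<close>
    if N: "Suc (Max (insert 0 (g ` {..<k}))) \<le> N" for N
  proof -
    have "g j < N" if "j < k" for j
    proof -
      have "g j \<le> Max (insert 0 (g ` {..<k}))" using that by (intro Max_ge) auto
      then show ?thesis using N by simp
    qed
    from ext_def_reindexed_closed[OF closedin_closure_of
        defset_closure[OF definable_imp_defset[OF r(2)] X] this]
    show ?thesis by (simp add: tuple r(1))
  qed
  then show ?case by blast
next
  case (Neg \<phi>)
  then obtain N\<^sub>0 where N: "\<And>N. N \<ge> N\<^sub>0 \<Longrightarrow> ext_def N {x \<in> tuples (carrier G) N. sat (open_core T \<MM>) x \<phi>}"
    by auto
  have "{x \<in> tuples (carrier G) N. sat (open_core T \<MM>) x (Neg \<phi>)}
      = tuples (carrier G) N - {x \<in> tuples (carrier G) N. sat (open_core T \<MM>) x \<phi>}" for N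
    by auto
  then show ?case using ext_def_compl[OF N] by (intro exI[of _ N\<^sub>0]) simp
next
  case (Conj \<phi> \<psi>)
  then obtain N\<^sub>1 N\<^sub>2
    where N: "\<And>N. N \<ge> N\<^sub>1 \<Longrightarrow> ext_def N {x \<in> tuples (carrier G) N. sat (open_core T \<MM>) x \<phi>}"
      "\<And>N. N \<ge> N\<^sub>2 \<Longrightarrow> ext_def N {x \<in> tuples (carrier G) N. sat (open_core T \<MM>) x \<psi>}"
    by auto
  have "{x \<in> tuples (carrier G) N. sat (open_core T \<MM>) x (Conj \<phi> \<psi>)}
      = {x \<in> tuples (carrier G) N. sat (open_core T \<MM>) x \<phi>} \<inter>
        {x \<in> tuples (carrier G) N. sat (open_core T \<MM>) x \<psi>}" for N
    by auto
  then show ?case using ext_def_Int[OF N] by (intro exI[of _ "max N\<^sub>1 N\<^sub>2"]) simp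
next
  case (Exists i \<phi>)
  then obtain N\<^sub>0 where N: "\<And>N. N \<ge> N\<^sub>0 \<Longrightarrow> ext_def N {x \<in> tuples (carrier G) N. sat (open_core T \<MM>) x \<phi>}"
    by auto
  have "ext_def N {x \<in> tuples (carrier G) N. sat (open_core T \<MM>) x (Exists i \<phi>)}"
    if le: "max N\<^sub>0 (Suc i) \<le> N" for N
  proof -
    have "x(i := a) \<in> tuples (carrier G) N" if "x \<in> tuples (carrier G) N" "a \<in> carrier G" for x a
      using that le by (auto simp: PiE_iff extensional_def)
    then have "{x \<in> tuples (carrier G) N. sat (open_core T \<MM>) x (Exists i \<phi>)}
        = {x \<in> tuples (carrier G) N. \<exists>a\<in>carrier G.
            x(i := a) \<in> {y \<in> tuples (carrier G) N. sat (open_core T \<MM>) y \<phi>}}"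
      by auto
    then show ?thesis using ext_def_project[OF N, of N i] le by simp
  qed
  then show ?case by blast
qed

text \<open>The induction on formulas treats parameters as further coordinates; here they are fixed,
  by moving \<open>d\<close> into the parameters of the separating family.\<close>

lemma ext_def_fibre:
  assumes "ext_def (n + l) A" "d \<in> tuples (carrier G) l"
  shows "ext_def n {x \<in> tuples (carrier G) n. tuple_join n l x d \<in> A}"
proof (rule ext_def_preimage[OF assms(1)])
  show "continuous_map (power_topology T n) (power_topology T (n + l)) (\<lambda>x. tuple_join n l x d)"
    using assms(2) by (intro continuous_map_tuple_join_left) simp
  fix q R assume R: "defrel \<MM> (n + l) q R"
  let ?Q = "\<lambda>d e. R (tuple_join n l (seg 0 n e) d) (seg n q e)"
  have "defpred \<MM> (\<lambda>e. R (tuple_join n l (seg l n e) (seg 0 l e)) (seg (l + n) q e))"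
    by (intro defrel_app[OF R] tuple_term_join tuple_term_seg)
  then have "defpred \<MM> (\<lambda>e. ?Q (seg 0 l e) (shift l e))" by simp
  then have "defpred \<MM> (?Q d)" using assms(2) by (rule defpred_const_tuple)
  then show "defrel \<MM> n q (\<lambda>x. R (tuple_join n l x d))" unfolding defrel_def .
qed

lemma definable_open_core_ext_def:
  assumes "definable (open_core T \<MM>) n X" shows "ext_def n X"
proof -
  let ?O = "open_core T \<MM>"
  obtain \<phi> m c where *: "c \<in> tuples (carrier G) m" "wf_fm ?O \<phi>" "fv \<phi> \<subseteq> {..<n + m}"
    "X = {x \<in> tuples (carrier G) n. sat ?O (tuple_append n x c) \<phi>}"
    using assms unfolding definable_def open_core_simps by (elim exE bexE conjE) (rule that)
  obtain N\<^sub>0 where N: "\<forall>N\<ge>N\<^sub>0. ext_def N {x \<in> tuples (carrier G) N. sat ?O x \<phi>}"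
    using open_core_ext_def[OF *(2)] by blast
  \<comment> \<open>Padding the parameters with \<open>N\<^sub>0\<close> copies of
    \<open>\<one>\<close> brings the length up to the threshold. The padding lies beyond the free
    variables of \<open>\<phi>\<close>, so its value does not matter.\<close>
  let ?l = "m + N\<^sub>0"
  define d where "d = (\<lambda>i\<in>{..<?l}. if i < m then c i else \<one>)"
  have d: "d \<in> tuples (carrier G) ?l" using *(1) by (auto simp: d_def PiE_iff)
  have "sat ?O (tuple_append n x c) \<phi> = sat ?O (tuple_join n ?l x d) \<phi>" for x
    by (rule sat_cong) (use *(3) in \<open>auto simp: tuple_append_def tuple_join_def d_def\<close>)
  then have X: "X = {x \<in> tuples (carrier G) n.
      tuple_join n ?l x d \<in> {y \<in> tuples (carrier G) (n + ?l). sat ?O y \<phi>}}"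
    using tuple_join_in_tuples[OF _ d] *(4) by auto
  have "ext_def (n + ?l) {y \<in> tuples (carrier G) (n + ?l). sat ?O y \<phi>}" using N by simp
  from ext_def_fibre[OF this d] show ?thesis unfolding X .
qed

end

theorem theoremA:
  fixes G :: "('a, 'b) monoid_scheme"
    and \<GG> :: "('f, 'r, 'a) fo_structure"
    and T :: "'a topology"
    and \<B> \<K> :: "'a set set"
  assumes "group G"
    and "expands_group \<GG> G"
    and "group_topology G T" and "locally_compact_space T" and "Hausdorff_space T"
    and "definable_family \<GG> \<B>" and "topology_basis T \<B>"
    and "definable_family \<GG> \<K>"
    and "\<And>K. K \<in> \<K> \<Longrightarrow> compactin T K"
    and "\<And>C. compactin T C \<Longrightarrow> \<exists>K\<in>\<K>. C \<subseteq> K"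
    and "NIP \<GG>"
  shows "strongly_noiseless T (open_core T \<GG>)"
proof -
  have universe: "universe \<GG> = carrier G"
    using assms(2) by (simp add: expands_group_def)
  obtain m B X where B: "definable \<GG> m B" "definable \<GG> (Suc m) X"
    "\<B> = (\<lambda>b. {x \<in> carrier G. b(m := x) \<in> X}) ` B"
    using assms(6) unfolding definable_family_def universe by (elim exE conjE) (rule that)
  obtain l C Y where C: "definable \<GG> l C" "definable \<GG> (Suc l) Y"
    "\<K> = (\<lambda>b. {x \<in> carrier G. b(l := x) \<in> Y}) ` C"
    using assms(8) unfolding definable_family_def universe by (elim exE conjE) (rule that)
  interpret definable_topological_group G T \<GG> m B X l C Y
  proof (intro definable_topological_group.intro topological_group.intro
      topological_group_axioms.intro definable_topological_group_axioms.intro)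
    show "B \<subseteq> tuples (carrier G) m" "C \<subseteq> tuples (carrier G) l"
      using definable_subset[OF B(1)] definable_subset[OF C(1)] universe by simp_all
    show "topology_basis T ((\<lambda>b. {x \<in> carrier G. b(m := x) \<in> X}) ` B)"
      using assms(7) B(3) by simp
    show "compactin T {x \<in> carrier G. c(l := x) \<in> Y}" if "c \<in> C" for c
      using assms(9) C(3) that by blast
    show "\<exists>c\<in>C. K \<subseteq> {x \<in> carrier G. c(l := x) \<in> Y}" if "compactin T K" for K
      using assms(10)[OF that] C(3) by blast
  qed (use assms B C definable_imp_defset in auto)
  show ?thesis
    unfolding strongly_noiseless_def
    using ext_def_noiseless[OF definable_open_core_ext_def] by blast
qed

end
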